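(* Let $\mathcal C$ be a small category and let $(\mathcal G_x,\varphi_g,u_{g,h})$ be data describing a $\mathcal C$-shaped diagram of tight correspondences between groups. Let $P$ be the path groupoid of the directed graph with vertex set $\mathcal C^0$ and edge set $\mathcal C\sqcup\bigsqcup_{x\in\mathcal C^0}\mathcal G_x$, where $g\in\mathcal C$ is an edge from $s(g)$ to $r(g)$ and $\gamma\in\mathcal G_x$ is a loop at $x$; that is, $P$ is the free groupoid on this graph, whose arrows are the reduced composable words in edges and their formal inverses. Let $\mathcal U$ be the quotient of $P$ by the family of normal subgroups generated by the following elements: (1) $\gamma_1\cdot\gamma_2\cdot(\gamma_1\gamma_2)^{-1}$ for all $x\in\mathcal C^0$, $\gamma_1,\gamma_2\in\mathcal G_x$; (2) $g\cdot\varphi_g(\gamma)\cdot g^{-1}\cdot\gamma^{-1}$ for all $g\in\mathcal C$, $\gamma\in\mathcal G_{r(g)}$; (3) $u_{g,h}^{-1}\cdot(gh)^{-1}\cdot g\cdot h$ for all composable $g,h\in\mathcal C$; (4) the edge $x$ for each identity arrow $x\in\mathcal C^0\subseteq\mathcal C$. Then the (discrete) groupoid $\mathcal U$ is a groupoid model for the diagram $F$ of tight group correspondences described by $(\mathcal G_x,\varphi_g,u_{g,h})$.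
   Context: Conventions. $\mathcal C$ also denotes the set of arrows of the category, $\mathcal C^0$ the objects, identified with identity arrows; $g\colon x\leftarrow y$ means $r(g)=x$, $s(g)=y$, and $gh$ is defined iff $s(g)=r(h)$. Groups are discrete groupoids with one object. Data. $(\mathcal G_x,\varphi_g,u_{g,h})$ consists of groups $\mathcal G_x$ for $x\in\mathcal C^0$, group homomorphisms $\varphi_g\colon\mathcal G_{r(g)}\to\mathcal G_{s(g)}$ for $g\in\mathcal C$, and elements $u_{g,h}\in\mathcal G_{s(h)}$ for composable $g,h\in\mathcal C$, such that $u_{g,h}\,\varphi_h(\varphi_g(\gamma))\,u_{g,h}^{-1}=\varphi_{gh}(\gamma)$ for $\gamma\in\mathcal G_{r(g)}$; $u_{gh,k}\,\varphi_k(u_{g,h})=u_{g,hk}\,u_{h,k}$ for composable $g,h,k$; $\varphi_x=\mathrm{id}$ for identity arrows $x$; $u_{r(g),g}=1$ and $u_{g,s(g)}=1$ for all $g\in\mathcal C$. The diagram $F=(\mathcal G_x,\mathcal X_g,\mu_{g,h})$ described by this data: $\mathcal X_g={}_{\varphi_g}\mathcal G_{s(g)}$, that is, the set $\mathcal G_{s(g)}$ with left $\mathcal G_{r(g)}$-action $\gamma\cdot\xi=\varphi_g(\gamma)\xi$ and right $\mathcal G_{s(g)}$-action by multiplication; the multiplication maps are $\mathcal X_g\times\mathcal X_h\to\mathcal X_{gh}$, $\gamma_1\cdot\gamma_2:=u_{g,h}\,\varphi_h(\gamma_1)\,\gamma_2$ (product in $\mathcal G_{s(h)}$), for composable $g,h$;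 these induce isomorphisms $\mu_{g,h}$ from the quotient of $\mathcal X_g\times\mathcal X_h$ by the diagonal action $(\xi,\eta)\sim(\xi\gamma^{-1},\gamma\eta)$ of $\mathcal G_{s(g)}$ to $\mathcal X_{gh}$. $F$-actions. An $F$-action on a topological space $Y$ consists of a partition $Y=\bigsqcup_{x\in\mathcal C^0}Y_x$ into clopen subsets and open, continuous, surjective maps $\mathcal X_g\times Y_{s(g)}\to Y_{r(g)}$, $(\gamma,y)\mapsto\gamma\cdot y$, for all $g\in\mathcal C$ (with $\mathcal X_g$ discrete), such that (i) $\gamma_1\cdot(\gamma_2\cdot y)=(\gamma_1\cdot\gamma_2)\cdot y$ for composable $g_1,g_2\in\mathcal C$, $\gamma_i\in\mathcal X_{g_i}$, $y\in Y_{s(g_2)}$; (ii) if $\gamma\cdot y=\gamma'\cdot y'$ with $\gamma,\gamma'\in\mathcal X_g$, $y,y'\in Y_{s(g)}$, then there is $\eta\in\mathcal G_{s(g)}$ with $\gamma'=\gamma\eta$ and $y=\eta\cdot y'$ (here $\mathcal G_x=\mathcal X_x$ acts on $Y_x$). A continuous map $\varphi\colon Y\to Y'$ between $F$-actions is $F$-equivariant if $\varphi(Y_x)\subseteq Y'_x$ for all $x$ and $\varphi(\gamma\cdot y)=\gamma\cdot\varphi(y)$ for all $g\in\mathcal C$, $\gamma\in\mathcal X_g$, $y\in Y_{s(g)}$. A groupoid model for $F$ is an étale topological groupoid $\mathcal U$ (range and source are local homeomorphisms) with natural bijections, for all topological spaces $Y$, between left $\mathcal U$-actions on $Y$ (continuous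 anchor map $Y\to\mathcal U^0$ and continuous, associative, unital multiplication) and $F$-actions on $Y$; naturality means that a continuous map $Y\to Y'$ is $\mathcal U$-equivariant iff it is $F$-equivariant. *)

theory Defs
  imports
    "HOL-Analysis.Analysis"
    "HOL-Algebra.Group"
    "Graph_Theory.Digraph"
begin

section \<open>Small categories and groupoids\<close>

text \<open>
  A category is given by its arrows alone; objects are identified with their identity arrows.
  An arrow \<open>g\<close> goes from \<open>src C g\<close> to \<open>rng C g\<close>, and \<open>cmp C g h\<close> is meaningful only if
  \<open>src C g = rng C h\<close>.
\<close>

record 'a cat = "'a partial_object" +
  src :: "'a \<Rightarrow> 'a"
  rng :: "'a \<Rightarrow> 'a"
  cmp :: "'a \<Rightarrow> 'a \<Rightarrow> 'a"

definition obj :: "('a, 'm) cat_scheme \<Rightarrow> 'a set" where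
  "obj C = src C ` carrier C"

locale small_category =
  fixes C :: "('a, 'm) cat_scheme"
  assumes src_closed: "g \<in> carrier C \<Longrightarrow> src C g \<in> carrier C"
    and rng_closed: "g \<in> carrier C \<Longrightarrow> rng C g \<in> carrier C"
    and src_src: "g \<in> carrier C \<Longrightarrow> src C (src C g) = src C g"
    and rng_src: "g \<in> carrier C \<Longrightarrow> rng C (src C g) = src C g"
    and src_rng: "g \<in> carrier C \<Longrightarrow> src C (rng C g) = rng C g"
    and rng_rng: "g \<in> carrier C \<Longrightarrow> rng C (rng C g) = rng C g"
    and comp_closed:
      "\<lbrakk>g \<in> carrier C; h \<in> carrier C; src C g = rng C h\<rbrakk> \<Longrightarrow> cmp C g h \<in> carrier C"
    and src_comp:
      "\<lbrakk>g \<in> carrier C; h \<in> carrier C; src C g = rng C h\<rbrakk> \<Longrightarrow> src C (cmp C g h) = src C h"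
    and rng_comp:
      "\<lbrakk>g \<in> carrier C; h \<in> carrier C; src C g = rng C h\<rbrakk> \<Longrightarrow> rng C (cmp C g h) = rng C g"
    and comp_assoc:
      "\<lbrakk>g \<in> carrier C; h \<in> carrier C; k \<in> carrier C; src C g = rng C h; src C h = rng C k\<rbrakk>
        \<Longrightarrow> cmp C (cmp C g h) k = cmp C g (cmp C h k)"
    and comp_rng: "g \<in> carrier C \<Longrightarrow> cmp C (rng C g) g = g"
    and comp_src: "g \<in> carrier C \<Longrightarrow> cmp C g (src C g) = g"

definition is_inverse :: "('a, 'm) cat_scheme \<Rightarrow> 'a \<Rightarrow> 'a \<Rightarrow> bool" where
  "is_inverse G g h \<longleftrightarrow> h \<in> carrier G \<and> src G h = rng G g \<and> rng G h = src G g \<and>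
     cmp G g h = rng G g \<and> cmp G h g = src G g"

definition ginv :: "('a, 'm) cat_scheme \<Rightarrow> 'a \<Rightarrow> 'a" where
  "ginv G g = (THE h. is_inverse G g h)"

locale small_groupoid = small_category +
  assumes inverse_exists: "g \<in> carrier C \<Longrightarrow> \<exists>h. is_inverse C g h"


section \<open>Quotients of groupoids\<close>

text \<open>
  A family of normal subgroups of the isotropy groups, conjugation invariant under all arrows,
  is represented by the union of its members.
\<close>

definition normal_family :: "('a, 'm) cat_scheme \<Rightarrow> 'a set \<Rightarrow> bool" where
  "normal_family G N \<longleftrightarrow>
     N \<subseteq> {n \<in> carrier G. src G n = rng G n} \<and>
     obj G \<subseteq> N \<and>
     (\<forall>m\<in>N. \<forall>n\<in>N. src G m = rng G n \<longrightarrow> cmp G m n \<in> N) \<and>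
     (\<forall>n\<in>N. ginv G n \<in> N) \<and>
     (\<forall>g\<in>carrier G. \<forall>n\<in>N. src G g = rng G n \<longrightarrow> cmp G (cmp G g n) (ginv G g) \<in> N)"

definition normal_family_generated :: "('a, 'm) cat_scheme \<Rightarrow> 'a set \<Rightarrow> 'a set" where
  "normal_family_generated G S = \<Inter>{N. normal_family G N \<and> S \<subseteq> N}"

definition left_coset :: "('a, 'm) cat_scheme \<Rightarrow> 'a set \<Rightarrow> 'a \<Rightarrow> 'a set" where
  "left_coset G N p = {cmp G p n |n. n \<in> N \<and> rng G n = src G p}"

text \<open>
  All elements of one coset have the same source and range, so the unions below are cosets again.
\<close>

definition quotient_groupoid :: "('a, 'm) cat_scheme \<Rightarrow> 'a set \<Rightarrow> 'a set cat" where
  "quotient_groupoid G N =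
     \<lparr> carrier = left_coset G N ` carrier G,
       src = (\<lambda>A. \<Union>a\<in>A. left_coset G N (src G a)),
       rng = (\<lambda>A. \<Union>a\<in>A. left_coset G N (rng G a)),
       cmp = (\<lambda>A B. {cmp G a b |a b. a \<in> A \<and> b \<in> B \<and> src G a = rng G b}) \<rparr>"


section \<open>The path groupoid of a directed graph\<close>

text \<open>
  A letter \<open>(e, True)\<close> is the edge \<open>e\<close>, and \<open>(e, False)\<close> is its formal inverse. Words are composed
  like arrows, that is, the source of a letter is the range of the next letter.
  The first component of an arrow \<open>(x, w)\<close> is its range; it is only needed for empty words.
\<close>

fun letter_rng :: "('v, 'e) pre_digraph \<Rightarrow> 'e \<times> bool \<Rightarrow> 'v" where
  "letter_rng \<Gamma> (e, b) = (if b then head \<Gamma> e else tail \<Gamma> e)"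

fun letter_src :: "('v, 'e) pre_digraph \<Rightarrow> 'e \<times> bool \<Rightarrow> 'v" where
  "letter_src \<Gamma> (e, b) = (if b then tail \<Gamma> e else head \<Gamma> e)"

fun letter_inv :: "'e \<times> bool \<Rightarrow> 'e \<times> bool" where
  "letter_inv (e, b) = (e, \<not> b)"

fun composable_word :: "('v, 'e) pre_digraph \<Rightarrow> 'v \<Rightarrow> ('e \<times> bool) list \<Rightarrow> bool" where
  "composable_word \<Gamma> x [] \<longleftrightarrow> x \<in> verts \<Gamma>"
| "composable_word \<Gamma> x (l # w) \<longleftrightarrow>
     fst l \<in> arcs \<Gamma> \<and> letter_rng \<Gamma> l = x \<and> composable_word \<Gamma> (letter_src \<Gamma> l) w"

fun word_src :: "('v, 'e) pre_digraph \<Rightarrow> 'v \<Rightarrow> ('e \<times> bool) list \<Rightarrow> 'v" where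
  "word_src \<Gamma> x [] = x"
| "word_src \<Gamma> x (l # w) = word_src \<Gamma> (letter_src \<Gamma> l) w"

definition reduced_word :: "('e \<times> bool) list \<Rightarrow> bool" where
  "reduced_word w \<longleftrightarrow> successively (\<lambda>l m. m \<noteq> letter_inv l) w"

fun push_letter :: "'e \<times> bool \<Rightarrow> ('e \<times> bool) list \<Rightarrow> ('e \<times> bool) list" where
  "push_letter l [] = [l]"
| "push_letter l (m # w) = (if m = letter_inv l then w else l # m # w)"

definition path_groupoid :: "('v, 'e) pre_digraph \<Rightarrow> ('v \<times> ('e \<times> bool) list) cat" where
  "path_groupoid \<Gamma> =
     \<lparr> carrier = {(x, w). composable_word \<Gamma> x w \<and> reduced_word w},
       src = (\<lambda>(x, w). (word_src \<Gamma> x w, [])),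
       rng = (\<lambda>(x, w). (x, [])),
       cmp = (\<lambda>(x, w) (y, v). (x, foldr push_letter w v)) \<rparr>"

definition edge_path :: "('v, 'e) pre_digraph \<Rightarrow> 'e \<Rightarrow> 'v \<times> ('e \<times> bool) list" where
  "edge_path \<Gamma> e = (head \<Gamma> e, [(e, True)])"


section \<open>Diagrams of tight correspondences between groups\<close>

text \<open>
  The conditions on \<open>u\<close> are a choice of units together with the usual cocycle identity.
  All groups live in one type; this is no restriction.
\<close>

locale group_diagram_data = small_category C
  for C :: "('c, 'm) cat_scheme" +
  fixes G :: "'c \<Rightarrow> ('b, 'n) monoid_scheme"
    and \<phi> :: "'c \<Rightarrow> 'b \<Rightarrow> 'b"
    and u :: "'c \<Rightarrow> 'c \<Rightarrow> 'b"
  assumes groups: "x \<in> obj C \<Longrightarrow> group (G x)"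
    and homs: "g \<in> carrier C \<Longrightarrow> \<phi> g \<in> hom (G (rng C g)) (G (src C g))"
    and u_closed:
      "\<lbrakk>g \<in> carrier C; h \<in> carrier C; src C g = rng C h\<rbrakk> \<Longrightarrow> u g h \<in> carrier (G (src C h))"
    and u_conj:
      "\<lbrakk>g \<in> carrier C; h \<in> carrier C; src C g = rng C h; \<gamma> \<in> carrier (G (rng C g))\<rbrakk> \<Longrightarrow>
        u g h \<otimes>\<^bsub>G (src C h)\<^esub> \<phi> h (\<phi> g \<gamma>) \<otimes>\<^bsub>G (src C h)\<^esub> inv\<^bsub>G (src C h)\<^esub> (u g h)
          = \<phi> (cmp C g h) \<gamma>"
    and u_cocycle:
      "\<lbrakk>g \<in> carrier C; h \<in> carrier C; k \<in> carrier C; src C g = rng C h; src C h = rng C k\<rbrakk> \<Longrightarrow>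
        u (cmp C g h) k \<otimes>\<^bsub>G (src C k)\<^esub> \<phi> k (u g h)
          = u g (cmp C h k) \<otimes>\<^bsub>G (src C k)\<^esub> u h k"
    and \<phi>_id: "\<lbrakk>x \<in> obj C; \<gamma> \<in> carrier (G x)\<rbrakk> \<Longrightarrow> \<phi> x \<gamma> = \<gamma>"
    and u_rng: "g \<in> carrier C \<Longrightarrow> u (rng C g) g = \<one>\<^bsub>G (src C g)\<^esub>"
    and u_src: "g \<in> carrier C \<Longrightarrow> u g (src C g) = \<one>\<^bsub>G (src C g)\<^esub>"

text \<open>
  \<open>corr F g\<close> is the bimodule of \<open>g\<close>, with left and right actions \<open>lact F g\<close> and \<open>ract F g\<close>;
  \<open>cmult F g h\<close> is the multiplication map on \<open>corr F g \<times> corr F h\<close> that induces the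
  isomorphism of the balanced product with \<open>corr F (g h)\<close>.
  Over an identity arrow \<open>x\<close>, the bimodule is the group itself.
\<close>

record ('c, 'b) group_diagram =
  shape :: "'c cat"
  grp :: "'c \<Rightarrow> 'b monoid"
  corr :: "'c \<Rightarrow> 'b set"
  lact :: "'c \<Rightarrow> 'b \<Rightarrow> 'b \<Rightarrow> 'b"
  ract :: "'c \<Rightarrow> 'b \<Rightarrow> 'b \<Rightarrow> 'b"
  cmult :: "'c \<Rightarrow> 'c \<Rightarrow> 'b \<Rightarrow> 'b \<Rightarrow> 'b"

definition diagram_of ::
  "'c cat \<Rightarrow> ('c \<Rightarrow> 'b monoid) \<Rightarrow> ('c \<Rightarrow> 'b \<Rightarrow> 'b) \<Rightarrow> ('c \<Rightarrow> 'c \<Rightarrow> 'b) \<Rightarrow> ('c, 'b) group_diagram"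
where
  "diagram_of C G \<phi> u =
     \<lparr> shape = C,
       grp = G,
       corr = (\<lambda>g. carrier (G (src C g))),
       lact = (\<lambda>g \<gamma> \<xi>. \<phi> g \<gamma> \<otimes>\<^bsub>G (src C g)\<^esub> \<xi>),
       ract = (\<lambda>g \<xi> \<gamma>. \<xi> \<otimes>\<^bsub>G (src C g)\<^esub> \<gamma>),
       cmult = (\<lambda>g h \<gamma>\<^sub>1 \<gamma>\<^sub>2. u g h \<otimes>\<^bsub>G (src C h)\<^esub> \<phi> h \<gamma>\<^sub>1 \<otimes>\<^bsub>G (src C h)\<^esub> \<gamma>\<^sub>2) \<rparr>"


section \<open>Actions of diagrams\<close>

text \<open>
  An action is a pair of the pieces \<open>x \<mapsto> Y\<^sub>x\<close> and the maps \<open>g \<mapsto> (\<gamma>, y) \<mapsto> \<gamma> \<cdot> y\<close>. Pieces may be empty.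
  Outside their domains, these functions take the value \<open>undefined\<close>, so that
  equality of pairs is equality of actions.
\<close>

type_synonym ('c, 'b, 'y) diagram_action = "('c \<Rightarrow> 'y set) \<times> ('c \<Rightarrow> 'b \<Rightarrow> 'y \<Rightarrow> 'y)"

definition diagram_actions ::
  "('c, 'b) group_diagram \<Rightarrow> 'y topology \<Rightarrow> ('c, 'b, 'y) diagram_action set"
where
  "diagram_actions F Y = {(P, a).
     P \<in> extensional (obj (shape F)) \<and>
     (\<forall>x\<in>obj (shape F). openin Y (P x) \<and> closedin Y (P x)) \<and>
     disjoint_family_on P (obj (shape F)) \<and>
     (\<Union>x\<in>obj (shape F). P x) = topspace Y \<and>
     (\<forall>g \<gamma> y. \<not> (g \<in> carrier (shape F) \<and> \<gamma> \<in> corr F g \<and> y \<in> P (src (shape F) g)) \<longrightarrow>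
        a g \<gamma> y = undefined) \<and>
     (\<forall>g\<in>carrier (shape F).
        let D = prod_topology (discrete_topology (corr F g)) (subtopology Y (P (src (shape F) g)));
            R = subtopology Y (P (rng (shape F) g));
            m = (\<lambda>(\<gamma>, y). a g \<gamma> y)
        in continuous_map D R m \<and> open_map D R m \<and> m ` topspace D = topspace R) \<and>
     (\<forall>g\<^sub>1\<in>carrier (shape F). \<forall>g\<^sub>2\<in>carrier (shape F). src (shape F) g\<^sub>1 = rng (shape F) g\<^sub>2 \<longrightarrow>
        (\<forall>\<gamma>\<^sub>1\<in>corr F g\<^sub>1. \<forall>\<gamma>\<^sub>2\<in>corr F g\<^sub>2. \<forall>y\<in>P (src (shape F) g\<^sub>2).
           a g\<^sub>1 \<gamma>\<^sub>1 (a g\<^sub>2 \<gamma>\<^sub>2 y) = a (cmp (shape F) g\<^sub>1 g\<^sub>2) (cmult F g\<^sub>1 g\<^sub>2 \<gamma>\<^sub>1 \<gamma>\<^sub>2) y)) \<and>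
     (\<forall>g\<in>carrier (shape F). \<forall>\<gamma>\<in>corr F g. \<forall>\<gamma>'\<in>corr F g.
        \<forall>y\<in>P (src (shape F) g). \<forall>y'\<in>P (src (shape F) g). a g \<gamma> y = a g \<gamma>' y' \<longrightarrow>
           (\<exists>\<eta>\<in>carrier (grp F (src (shape F) g)).
              \<gamma>' = ract F g \<gamma> \<eta> \<and> y = a (src (shape F) g) \<eta> y'))}"

definition diagram_equivariant ::
  "('c, 'b) group_diagram \<Rightarrow> ('c, 'b, 'y) diagram_action \<Rightarrow> ('c, 'b, 'z) diagram_action \<Rightarrow>
    ('y \<Rightarrow> 'z) \<Rightarrow> bool"
where
  "diagram_equivariant F = (\<lambda>(P, a) (P', a') f.
     (\<forall>x\<in>obj (shape F). f ` P x \<subseteq> P' x) \<and>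
     (\<forall>g\<in>carrier (shape F). \<forall>\<gamma>\<in>corr F g. \<forall>y\<in>P (src (shape F) g).
        f (a g \<gamma> y) = a' g \<gamma> (f y)))"


section \<open>Etale groupoids and their actions\<close>

record 'a topological_cat = "'a cat" +
  arrow_top :: "'a topology"

abbreviation object_top :: "('a, 'm) topological_cat_scheme \<Rightarrow> 'a topology" where
  "object_top U \<equiv> subtopology (arrow_top U) (obj U)"

definition local_homeomorphism_map :: "'a topology \<Rightarrow> 'b topology \<Rightarrow> ('a \<Rightarrow> 'b) \<Rightarrow> bool" where
  "local_homeomorphism_map X Y f \<longleftrightarrow>
     (\<forall>x\<in>topspace X. \<exists>V. x \<in> V \<and> openin X V \<and> openin Y (f ` V) \<and>
        homeomorphic_map (subtopology X V) (subtopology Y (f ` V)) f)"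

locale etale_groupoid = small_groupoid U
  for U :: "('a, 'm) topological_cat_scheme" +
  assumes topspace_arrow_top: "topspace (arrow_top U) = carrier U"
    and continuous_comp:
      "continuous_map
         (subtopology (prod_topology (arrow_top U) (arrow_top U)) {(g, h). src U g = rng U h})
         (arrow_top U) (\<lambda>(g, h). cmp U g h)"
    and continuous_ginv: "continuous_map (arrow_top U) (arrow_top U) (ginv U)"
    and local_homeomorphism_src: "local_homeomorphism_map (arrow_top U) (object_top U) (src U)"
    and local_homeomorphism_rng: "local_homeomorphism_map (arrow_top U) (object_top U) (rng U)"

definition discrete_groupoid :: "'a cat \<Rightarrow> 'a topological_cat" where
  "discrete_groupoid G = cat.extend G \<lparr> arrow_top = discrete_topology (carrier G) \<rparr>"

text \<open>
  A left action is a pair of the anchor map and the multiplication map, again \<open>undefined\<close> outside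
  their domains.
\<close>

type_synonym ('a, 'y) groupoid_action = "('y \<Rightarrow> 'a) \<times> ('a \<Rightarrow> 'y \<Rightarrow> 'y)"

definition groupoid_actions ::
  "('a, 'm) topological_cat_scheme \<Rightarrow> 'y topology \<Rightarrow> ('a, 'y) groupoid_action set"
where
  "groupoid_actions U Y = {(\<rho>, m).
     \<rho> \<in> extensional (topspace Y) \<and>
     (\<forall>g y. \<not> (g \<in> carrier U \<and> y \<in> topspace Y \<and> src U g = \<rho> y) \<longrightarrow> m g y = undefined) \<and>
     continuous_map Y (object_top U) \<rho> \<and>
     continuous_map (subtopology (prod_topology (arrow_top U) Y) {(g, y). src U g = \<rho> y}) Y
       (\<lambda>(g, y). m g y) \<and>
     (\<forall>g\<in>carrier U. \<forall>y\<in>topspace Y. src U g = \<rho> y \<longrightarrow> \<rho> (m g y) = rng U g) \<and>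
     (\<forall>g\<in>carrier U. \<forall>h\<in>carrier U. \<forall>y\<in>topspace Y. src U g = rng U h \<longrightarrow> src U h = \<rho> y \<longrightarrow>
        m g (m h y) = m (cmp U g h) y) \<and>
     (\<forall>y\<in>topspace Y. m (\<rho> y) y = y)}"

definition groupoid_equivariant ::
  "('a, 'm) topological_cat_scheme \<Rightarrow> 'y topology \<Rightarrow>
    ('a, 'y) groupoid_action \<Rightarrow> ('a, 'z) groupoid_action \<Rightarrow> ('y \<Rightarrow> 'z) \<Rightarrow> bool"
where
  "groupoid_equivariant U Y = (\<lambda>(\<rho>, m) (\<rho>', m') f.
     (\<forall>y\<in>topspace Y. \<rho>' (f y) = \<rho> y) \<and>
     (\<forall>g\<in>carrier U. \<forall>y\<in>topspace Y. src U g = \<rho> y \<longrightarrow> f (m g y) = m' g (f y)))"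


section \<open>Groupoid models\<close>

text \<open>
  HOL cannot quantify over types in a formula, so ``all topological spaces'' are all topologies on
  arbitrary subsets of a type \<open>'y\<close>, which is a parameter and plays the role of a universe. Spaces
  over different types, even a family of them indexed by a type, are compared inside a common sum
  or product type.
\<close>

definition groupoid_model ::
  "'y itself \<Rightarrow> ('c, 'b) group_diagram \<Rightarrow> ('a, 'm) topological_cat_scheme \<Rightarrow> bool"
where
  "groupoid_model (universe :: 'y itself) F U \<longleftrightarrow>
     etale_groupoid U \<and>
     (\<exists>\<Phi> :: 'y topology \<Rightarrow> ('a, 'y) groupoid_action \<Rightarrow> ('c, 'b, 'y) diagram_action.
        (\<forall>Y. bij_betw (\<Phi> Y) (groupoid_actions U Y) (diagram_actions F Y)) \<and>
        (\<forall>Y Y' f. continuous_map Y Y' f \<longrightarrow>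
           (\<forall>\<alpha>\<in>groupoid_actions U Y. \<forall>\<alpha>'\<in>groupoid_actions U Y'.
              groupoid_equivariant U Y \<alpha> \<alpha>' f \<longleftrightarrow>
              diagram_equivariant F (\<Phi> Y \<alpha>) (\<Phi> Y' \<alpha>') f)))"


section \<open>The groupoid given by generators and relations\<close>

text \<open>The edges are the arrows of \<open>C\<close> and the loops \<open>(x, \<gamma>)\<close> at \<open>x\<close> for \<open>\<gamma>\<close> in \<open>G x\<close>.\<close>

definition data_graph :: "'c cat \<Rightarrow> ('c \<Rightarrow> 'b monoid) \<Rightarrow> ('c, 'c + 'c \<times> 'b) pre_digraph" where
  "data_graph C G =
     \<lparr> verts = obj C,
       arcs = carrier C <+> (SIGMA x : obj C. carrier (G x)),
       tail = case_sum (src C) fst,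
       head = case_sum (rng C) fst \<rparr>"

definition relators ::
  "'c cat \<Rightarrow> ('c \<Rightarrow> 'b monoid) \<Rightarrow> ('c \<Rightarrow> 'b \<Rightarrow> 'b) \<Rightarrow> ('c \<Rightarrow> 'c \<Rightarrow> 'b) \<Rightarrow>
    ('c \<times> (('c + 'c \<times> 'b) \<times> bool) list) set"
where
  "relators C G \<phi> u =
    (let P = path_groupoid (data_graph C G);
         arrow = (\<lambda>g. edge_path (data_graph C G) (Inl g));
         loop = (\<lambda>x \<gamma>. edge_path (data_graph C G) (Inr (x, \<gamma>)))
     in
       {cmp P (cmp P (loop x \<gamma>\<^sub>1) (loop x \<gamma>\<^sub>2)) (ginv P (loop x (\<gamma>\<^sub>1 \<otimes>\<^bsub>G x\<^esub> \<gamma>\<^sub>2))) |x \<gamma>\<^sub>1 \<gamma>\<^sub>2.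
          x \<in> obj C \<and> \<gamma>\<^sub>1 \<in> carrier (G x) \<and> \<gamma>\<^sub>2 \<in> carrier (G x)} \<union>
       {cmp P (cmp P (cmp P (arrow g) (loop (src C g) (\<phi> g \<gamma>))) (ginv P (arrow g)))
            (ginv P (loop (rng C g) \<gamma>)) |g \<gamma>.
          g \<in> carrier C \<and> \<gamma> \<in> carrier (G (rng C g))} \<union>
       {cmp P (cmp P (cmp P (ginv P (loop (src C h) (u g h))) (ginv P (arrow (cmp C g h))))
            (arrow g)) (arrow h) |g h.
          g \<in> carrier C \<and> h \<in> carrier C \<and> src C g = rng C h} \<union>
       {arrow x |x. x \<in> obj C})"

definition presented_groupoid ::
  "'c cat \<Rightarrow> ('c \<Rightarrow> 'b monoid) \<Rightarrow> ('c \<Rightarrow> 'b \<Rightarrow> 'b) \<Rightarrow> ('c \<Rightarrow> 'c \<Rightarrow> 'b) \<Rightarrow>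
    ('c \<times> (('c + 'c \<times> 'b) \<times> bool) list) set cat"
where
  "presented_groupoid C G \<phi> u =
     quotient_groupoid (path_groupoid (data_graph C G))
       (normal_family_generated (path_groupoid (data_graph C G)) (relators C G \<phi> u))"

end

theory Submission
  imports Defs
begin

text \<open>
  Both kinds of actions are the same thing because the relators are exactly what the axioms of a
  diagram action say about the maps \<open>y \<mapsto> \<gamma> \<cdot> y\<close>.

  Let \<open>U\<close> be the groupoid with the given generators and relators. An action of \<open>U\<close> on \<open>Y\<close> has an
  anchor map to a discrete space, so \<open>Y\<close> splits into clopen fibres over the objects, and each arrow
  acts by a homeomorphism between two fibres. An element \<open>\<gamma>\<close> of the bimodule of \<open>g\<close> gives the arrow
  \<open>E g \<gamma> = g \<cdot> \<gamma>\<close>, and letting it act through this arrow defines a diagram action. The relators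
  yield \<open>E g \<gamma>\<^sub>1 \<cdot> E h \<gamma>\<^sub>2 = E (g h) (\<gamma>\<^sub>1 \<cdot> \<gamma>\<^sub>2)\<close> (lemma \<open>E_mult\<close>), which is the associativity condition.

  Conversely, in a diagram action every bimodule element acts by a homeomorphism: surjectivity of
  the whole multiplication map and the simply transitive right action of the group on the bimodule
  make each single map surjective, and the last axiom makes it injective (lemma
  \<open>a_homeomorphic_map\<close>). Hence the edges of the graph act by homeomorphisms, and since the path
  groupoid is free, this extends to an action of all paths. The arrows that act trivially form a
  normal family (lemma \<open>normal_family_kernel\<close>), which contains the relators (lemma
  \<open>relators_act_trivially\<close>). So the action of paths descends to the quotient \<open>U\<close>.

  A map is equivariant for all arrows of \<open>U\<close> if and only if it is equivariant for the generators
  (lemma \<open>equivariant_iff\<close>). This is naturality, and applied to the identity map it also shows that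
  an action of \<open>U\<close> is determined by its diagram action.
\<close>


section \<open>Calculus in groupoids\<close>

text \<open>
  As rewrite rules, the category axioms reassociate products to the right, and cancellation of
  neighbouring inverses then brings products of arrows and inverses to a normal form.
\<close>

declare (in small_category)
  src_closed [simp] rng_closed [simp] src_src [simp] rng_src [simp] src_rng [simp] rng_rng [simp]
  comp_closed [simp] src_comp [simp] rng_comp [simp] comp_assoc [simp] comp_rng [simp] comp_src [simp]

context small_category
begin

lemma obj_closed: "x \<in> obj C \<Longrightarrow> x \<in> carrier C"
  by (auto simp: obj_def)

lemma src_obj: "x \<in> obj C \<Longrightarrow> src C x = x"
  by (auto simp: obj_def)

lemma rng_obj: "x \<in> obj C \<Longrightarrow> rng C x = x"
  by (auto simp: obj_def)

lemma src_in_obj: "g \<in> carrier C \<Longrightarrow> src C g \<in> obj C"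
  by (auto simp: obj_def)

lemma rng_in_obj: "g \<in> carrier C \<Longrightarrow> rng C g \<in> obj C"
  by (metis obj_def imageI rng_closed src_rng)

lemma is_inverse_sym: "g \<in> carrier C \<Longrightarrow> is_inverse C g g' \<Longrightarrow> is_inverse C g' g"
  by (auto simp: is_inverse_def)

lemma is_inverse_cancel:
  assumes "g \<in> carrier C" "is_inverse C g g'" "h \<in> carrier C" "rng C h = rng C g"
  shows "cmp C g (cmp C g' h) = h"
proof -
  have "cmp C g (cmp C g' h) = cmp C (cmp C g g') h"
    by (rule comp_assoc[symmetric]) (use assms in \<open>auto simp: is_inverse_def\<close>)
  also have "\<dots> = cmp C (rng C h) h"
    using assms by (simp add: is_inverse_def)
  finally show ?thesis
    using assms(3) by simp
qed

lemma is_inverse_unique: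
  assumes "g \<in> carrier C" "is_inverse C g h" "is_inverse C g k"
  shows "h = k"
proof -
  have h: "h \<in> carrier C" "src C h = rng C g" "rng C h = src C g"
    and k: "k \<in> carrier C" "rng C k = src C g" "cmp C g k = rng C g"
    using assms by (auto simp: is_inverse_def)
  have "k = cmp C h (cmp C g k)"
    using is_inverse_cancel[OF h(1) is_inverse_sym, OF assms(1,2) k(1)] h k by simp
  also have "\<dots> = cmp C h (src C h)"
    using h(2) k(3) by simp
  finally show ?thesis
    using h(1) by simp
qed

lemma ginv_eqI: "g \<in> carrier C \<Longrightarrow> is_inverse C g h \<Longrightarrow> ginv C g = h"
  unfolding ginv_def using is_inverse_unique by blast

lemma is_inverse_cmp:
  assumes "g \<in> carrier C" "h \<in> carrier C" "src C g = rng C h"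
    and g': "is_inverse C g g'" and h': "is_inverse C h h'"
  shows "is_inverse C (cmp C g h) (cmp C h' g')"
proof -
  have 1: "g' \<in> carrier C" "src C g' = rng C g" "rng C g' = src C g"
    "cmp C g g' = rng C g" "cmp C h' h = src C h"
    "h' \<in> carrier C" "src C h' = rng C h" "rng C h' = src C h"
    using g' h' by (auto simp: is_inverse_def)
  have 2: "cmp C h (cmp C h' g') = g'" "cmp C g' (cmp C g h) = h"
    using assms 1 is_inverse_sym is_inverse_cancel by simp_all
  show ?thesis
    unfolding is_inverse_def using assms(1-3) 1 2 by simp
qed

end

context small_groupoid
begin

lemma is_inverse_ginv:
  assumes "g \<in> carrier C"
  shows "is_inverse C g (ginv C g)"
  using assms ginv_eqI inverse_exists by metis

lemma ginv_closed [simp]: "g \<in> carrier C \<Longrightarrow> ginv C g \<in> carrier C"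
  and src_ginv [simp]: "g \<in> carrier C \<Longrightarrow> src C (ginv C g) = rng C g"
  and rng_ginv [simp]: "g \<in> carrier C \<Longrightarrow> rng C (ginv C g) = src C g"
  and cmp_ginv [simp]: "g \<in> carrier C \<Longrightarrow> cmp C g (ginv C g) = rng C g"
  and ginv_cmp [simp]: "g \<in> carrier C \<Longrightarrow> cmp C (ginv C g) g = src C g"
  using is_inverse_ginv unfolding is_inverse_def by auto

lemma ginv_ginv [simp]: "g \<in> carrier C \<Longrightarrow> ginv C (ginv C g) = g"
  by (rule ginv_eqI) (auto simp: is_inverse_def)

lemma ginv_of_cmp [simp]:
  "\<lbrakk>g \<in> carrier C; h \<in> carrier C; src C g = rng C h\<rbrakk> \<Longrightarrow>
    ginv C (cmp C g h) = cmp C (ginv C h) (ginv C g)"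
  by (rule ginv_eqI) (auto intro: is_inverse_cmp is_inverse_ginv)


lemma ginv_obj: "x \<in> obj C \<Longrightarrow> ginv C x = x"
  using comp_src[of x] by (intro ginv_eqI) (simp_all add: is_inverse_def obj_closed src_obj rng_obj)

lemma ginv_cmp_cancel [simp]:
  assumes "g \<in> carrier C" "h \<in> carrier C" "src C g = rng C h"
  shows "cmp C (ginv C g) (cmp C g h) = h"
proof -
  have "cmp C (ginv C g) (cmp C g h) = cmp C (cmp C (ginv C g) g) h"
    using assms by (simp del: ginv_cmp)
  then show ?thesis using assms by simp
qed

lemma cmp_ginv_cancel [simp]:
  assumes "g \<in> carrier C" "h \<in> carrier C" "rng C g = rng C h"
  shows "cmp C g (cmp C (ginv C g) h) = h"
  using ginv_cmp_cancel[of "ginv C g" h] assms by simp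

end


section \<open>Quotients by families of normal subgroups\<close>

locale normal_quotient = small_groupoid +
  fixes N
  assumes normal: "normal_family C N"
begin

abbreviation coset where "coset \<equiv> left_coset C N"

abbreviation Q where "Q \<equiv> quotient_groupoid C N"

lemma N_closed: "n \<in> N \<Longrightarrow> n \<in> carrier C"
  and N_isotropy: "n \<in> N \<Longrightarrow> rng C n = src C n"
  and obj_N: "x \<in> obj C \<Longrightarrow> x \<in> N"
  and N_cmp: "\<lbrakk>m \<in> N; n \<in> N; src C m = rng C n\<rbrakk> \<Longrightarrow> cmp C m n \<in> N"
  and N_ginv: "n \<in> N \<Longrightarrow> ginv C n \<in> N"
  and N_conj: "\<lbrakk>g \<in> carrier C; n \<in> N; src C g = rng C n\<rbrakk> \<Longrightarrow> cmp C g (cmp C n (ginv C g)) \<in> N"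
proof -
  note * = normal[unfolded normal_family_def]
  show 1: "n \<in> carrier C" "rng C n = src C n" if "n \<in> N" for n using * that by auto
  show "x \<in> obj C \<Longrightarrow> x \<in> N" using * by auto
  show "\<lbrakk>m \<in> N; n \<in> N; src C m = rng C n\<rbrakk> \<Longrightarrow> cmp C m n \<in> N" using * by auto
  show "n \<in> N \<Longrightarrow> ginv C n \<in> N" using * by auto
  assume g: "g \<in> carrier C" and n: "n \<in> N" and gn: "src C g = rng C n"
  then have "cmp C (cmp C g n) (ginv C g) \<in> N" using * by auto
  then show "cmp C g (cmp C n (ginv C g)) \<in> N" using g gn 1[OF n] by simp
qed

lemma mem_coset_iff:
  assumes "p \<in> carrier C"
  shows "a \<in> coset p \<longleftrightarrow>
    a \<in> carrier C \<and> src C a = src C p \<and> rng C a = rng C p \<and> cmp C (ginv C p) a \<in> N"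
    (is "_ \<longleftrightarrow> ?R")
proof
  assume "a \<in> coset p"
  then obtain n where "n \<in> N" "rng C n = src C p" "a = cmp C p n"
    unfolding left_coset_def by auto
  then show ?R using assms N_closed[of n] N_isotropy[of n] by simp
next
  assume R: ?R
  then have "a = cmp C p (cmp C (ginv C p) a)" using assms by simp
  then show "a \<in> coset p" using R assms unfolding left_coset_def by fastforce
qed

lemma coset_self: "p \<in> carrier C \<Longrightarrow> p \<in> coset p"
  by (simp add: mem_coset_iff obj_N src_in_obj)

lemma coset_eq_iff:
  assumes p: "p \<in> carrier C" and p': "p' \<in> carrier C"
  shows "coset p = coset p' \<longleftrightarrow>
    src C p = src C p' \<and> rng C p = rng C p' \<and> cmp C (ginv C p) p' \<in> N" (is "_ \<longleftrightarrow> ?R")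
proof
  assume "coset p = coset p'"
  then have "p' \<in> coset p" using coset_self p' by simp
  then show ?R using mem_coset_iff[OF p] by simp
next
  assume R: ?R
  have *: "coset b \<subseteq> coset c"
    if b: "b \<in> carrier C" and c: "c \<in> carrier C" and bc: "src C b = src C c" "rng C b = rng C c"
      and n: "cmp C (ginv C c) b \<in> N" for b c
  proof
    fix a assume "a \<in> coset b"
    then have a: "a \<in> carrier C" "src C a = src C b" "rng C a = rng C b" "cmp C (ginv C b) a \<in> N"
      using mem_coset_iff[OF b] by auto
    then have "cmp C (cmp C (ginv C c) b) (cmp C (ginv C b) a) \<in> N"
      using b c bc by (intro N_cmp[OF n a(4)]) simp
    then show "a \<in> coset c"
      using a b c bc by (simp add: mem_coset_iff)
  qed
  have "cmp C (ginv C p') p \<in> N"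
    using N_ginv[of "cmp C (ginv C p) p'"] R p p' by simp
  with R show "coset p = coset p'" using *[OF p p'] *[OF p' p] by auto
qed

text \<open>
  A relator has one of the forms \<open>p\<inverse> p'\<close> and \<open>p p'\<inverse>\<close> with parallel arrows \<open>p\<close> and \<open>p'\<close>. Both
  forms give the equation between the cosets of \<open>p\<close> and \<open>p'\<close>; the second one does because
  conjugation by \<open>p'\<inverse>\<close> maps it to the first one for the exchanged arrows.
\<close>

lemma coset_eqI_left:
  "\<lbrakk>p \<in> carrier C; p' \<in> carrier C; src C p = src C p'; rng C p = rng C p'; cmp C (ginv C p) p' \<in> N\<rbrakk>
    \<Longrightarrow> coset p = coset p'"
  by (simp add: coset_eq_iff)

lemma coset_eqI_right:
  assumes "p \<in> carrier C" "p' \<in> carrier C" "src C p = src C p'" "rng C p = rng C p'"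
    and "cmp C p (ginv C p') \<in> N"
  shows "coset p = coset p'"
proof -
  have "cmp C (ginv C p') (cmp C (cmp C p (ginv C p')) (ginv C (ginv C p'))) \<in> N"
    by (rule N_conj) (use assms in auto)
  moreover have "cmp C p (src C p') = p"
    using assms comp_src by metis
  ultimately have "cmp C (ginv C p') p \<in> N"
    using assms by simp
  then show ?thesis using assms coset_eqI_left[of p' p] by simp
qed

lemma carrier_Q: "carrier Q = coset ` carrier C"
  by (simp add: quotient_groupoid_def)

lemma coset_closed: "p \<in> carrier C \<Longrightarrow> coset p \<in> carrier Q"
  by (simp add: carrier_Q)

lemma src_coset:
  assumes "p \<in> carrier C" shows "src Q (coset p) = coset (src C p)"
  using assms coset_self by (force simp: quotient_groupoid_def mem_coset_iff)

lemma rng_coset: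
  assumes "p \<in> carrier C" shows "rng Q (coset p) = coset (rng C p)"
  using assms coset_self by (force simp: quotient_groupoid_def mem_coset_iff)

lemma coset_obj_eq_iff: "\<lbrakk>x \<in> obj C; y \<in> obj C\<rbrakk> \<Longrightarrow> coset x = coset y \<longleftrightarrow> x = y"
  using coset_eq_iff obj_closed src_obj by metis

lemma coset_src_eq_rng_iff:
  "\<lbrakk>p \<in> carrier C; p' \<in> carrier C\<rbrakk> \<Longrightarrow> coset (src C p) = coset (rng C p') \<longleftrightarrow> src C p = rng C p'"
  by (simp add: coset_obj_eq_iff src_in_obj rng_in_obj)

lemma cmp_coset:
  assumes p: "p \<in> carrier C" and p': "p' \<in> carrier C" and pp': "src C p = rng C p'"
  shows "cmp Q (coset p) (coset p') = coset (cmp C p p')"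
proof (rule Set.set_eqI)
  fix c
  \<comment> \<open>A factor \<open>n\<close> between \<open>p\<close> and \<open>p'\<close> moves to the right end after conjugation by the inverse of \<open>p'\<close>.\<close>
  have "cmp C a b \<in> coset (cmp C p p')" if "a \<in> coset p" "b \<in> coset p'" for a b
  proof -
    obtain n k where n: "n \<in> N" "rng C n = src C p" "a = cmp C p n"
      and k: "k \<in> N" "rng C k = src C p'" "b = cmp C p' k"
      using \<open>a \<in> coset p\<close> \<open>b \<in> coset p'\<close> unfolding left_coset_def by auto
    let ?m = "cmp C (ginv C p') (cmp C n (ginv C (ginv C p')))"
    have "?m \<in> N" using n p' pp' by (intro N_conj) auto
    then have "cmp C ?m k \<in> N"
      using k n N_closed N_isotropy p' pp' by (intro N_cmp[OF _ k(1)]) auto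
    moreover have "cmp C a b = cmp C (cmp C p p') (cmp C ?m k)"
      using n k N_closed N_isotropy[of n] p p' pp' by simp
    moreover have "rng C (cmp C ?m k) = src C (cmp C p p')"
      using n k N_closed N_isotropy[of n] p p' pp' by simp
    ultimately show ?thesis unfolding left_coset_def by blast
  qed
  moreover have "\<exists>a b. c = cmp C a b \<and> a \<in> coset p \<and> b \<in> coset p' \<and> src C a = rng C b"
    if "c \<in> coset (cmp C p p')"
  proof -
    obtain k where k: "k \<in> N" "rng C k = src C p'" "c = cmp C (cmp C p p') k"
      using \<open>c \<in> coset (cmp C p p')\<close> p p' pp' unfolding left_coset_def by auto
    moreover have "cmp C p' k \<in> coset p'" using k unfolding left_coset_def by auto
    ultimately show ?thesis
      using p p' pp' N_closed coset_self by (intro exI[of _ p] exI[of _ "cmp C p' k"]) simp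
  qed
  ultimately show "c \<in> cmp Q (coset p) (coset p') \<longleftrightarrow> c \<in> coset (cmp C p p')"
    by (auto simp: quotient_groupoid_def)
qed

lemma obj_Q: "obj Q = coset ` obj C"
  by (auto simp: obj_def carrier_Q src_coset image_image)

lemmas quotient_simps = src_coset rng_coset cmp_coset coset_closed coset_src_eq_rng_iff

text \<open>The coset map is a functor onto the quotient, so all axioms are inherited.\<close>

lemma quotient_small_groupoid: "small_groupoid Q"
proof
  fix A assume "A \<in> carrier Q"
  then obtain p where p: "p \<in> carrier C" "A = coset p" by (auto simp: carrier_Q)
  then show "src Q A \<in> carrier Q" "rng Q A \<in> carrier Q"
    "src Q (src Q A) = src Q A" "rng Q (src Q A) = src Q A"
    "src Q (rng Q A) = rng Q A" "rng Q (rng Q A) = rng Q A"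
    "cmp Q (rng Q A) A = A" "cmp Q A (src Q A) = A"
    by (simp_all add: quotient_simps)
  have "is_inverse Q A (coset (ginv C p))"
    using p by (simp add: is_inverse_def quotient_simps)
  then show "\<exists>B. is_inverse Q A B" ..
next
  fix A B assume "A \<in> carrier Q" "B \<in> carrier Q" and AB: "src Q A = rng Q B"
  then obtain p q where p: "p \<in> carrier C" "A = coset p" and q: "q \<in> carrier C" "B = coset q"
    by (auto simp: carrier_Q)
  with AB have pq: "src C p = rng C q" by (simp add: quotient_simps)
  show "cmp Q A B \<in> carrier Q" "src Q (cmp Q A B) = src Q B" "rng Q (cmp Q A B) = rng Q A"
    using p q pq by (simp_all add: quotient_simps)
  fix D assume "D \<in> carrier Q" and BD: "src Q B = rng Q D"
  then obtain r where r: "r \<in> carrier C" "D = coset r" by (auto simp: carrier_Q)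
  with BD q have "src C q = rng C r" by (simp add: quotient_simps)
  then show "cmp Q (cmp Q A B) D = cmp Q A (cmp Q B D)"
    using p q r pq by (simp add: quotient_simps)
qed

lemma ginv_coset: "p \<in> carrier C \<Longrightarrow> ginv Q (coset p) = coset (ginv C p)"
  using small_category.ginv_eqI[OF small_groupoid.axioms(1)[OF quotient_small_groupoid]]
  by (simp add: is_inverse_def quotient_simps)

end

text \<open>
  The isotropy arrows form the largest family of normal subgroups. So the intersection that
  defines the generated family is over a nonempty set as soon as the generators are isotropy arrows.
\<close>

lemma (in small_groupoid) normal_family_isotropy:
  "normal_family C {n \<in> carrier C. src C n = rng C n}"
  by (auto simp: normal_family_def obj_def)

lemma (in small_groupoid) normal_family_generated:
  assumes "S \<subseteq> {n \<in> carrier C. src C n = rng C n}"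
  shows "normal_family C (normal_family_generated C S)"
proof -
  have *: "normal_family_generated C S \<subseteq> {n \<in> carrier C. src C n = rng C n}"
    unfolding normal_family_generated_def using assms normal_family_isotropy by auto
  show ?thesis
    unfolding normal_family_def
  proof (intro conjI *)
  qed (auto simp: normal_family_generated_def normal_family_def)
qed

lemma generators_in_normal_family_generated: "S \<subseteq> normal_family_generated C S"
  by (auto simp: normal_family_generated_def)

lemma normal_family_generated_least:
  "normal_family C N \<Longrightarrow> S \<subseteq> N \<Longrightarrow> normal_family_generated C S \<subseteq> N"
  by (auto simp: normal_family_generated_def)

section \<open>Groupoids acting on families of sets\<close>

locale groupoid_set_action = small_groupoid +
  fixes X :: "'a \<Rightarrow> 'y set" and act :: "'a \<Rightarrow> 'y \<Rightarrow> 'y"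
  assumes act_closed: "\<lbrakk>g \<in> carrier C; y \<in> X (src C g)\<rbrakk> \<Longrightarrow> act g y \<in> X (rng C g)"
    and act_cmp: "\<lbrakk>g \<in> carrier C; h \<in> carrier C; src C g = rng C h; y \<in> X (src C h)\<rbrakk> \<Longrightarrow>
      act (cmp C g h) y = act g (act h y)"
    and act_obj: "\<lbrakk>x \<in> obj C; y \<in> X x\<rbrakk> \<Longrightarrow> act x y = y"
begin

definition kernel :: "'a set" where
  "kernel = {n \<in> carrier C. src C n = rng C n \<and> (\<forall>y\<in>X (src C n). act n y = y)}"

lemma act_ginv: "\<lbrakk>g \<in> carrier C; y \<in> X (rng C g)\<rbrakk> \<Longrightarrow> act g (act (ginv C g) y) = y"
  using act_cmp[of g "ginv C g" y] by (simp add: act_obj rng_in_obj)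

lemma ginv_act: "\<lbrakk>g \<in> carrier C; y \<in> X (src C g)\<rbrakk> \<Longrightarrow> act (ginv C g) (act g y) = y"
  using act_cmp[of "ginv C g" g y] by (simp add: act_obj src_in_obj)

lemma normal_family_kernel: "normal_family C kernel"
  unfolding normal_family_def
proof (intro conjI ballI impI)
  show "kernel \<subseteq> {n \<in> carrier C. src C n = rng C n}" by (auto simp: kernel_def)
  show "obj C \<subseteq> kernel"
    by (auto simp: kernel_def obj_closed src_obj rng_obj act_obj)
  show "cmp C m n \<in> kernel" if "m \<in> kernel" "n \<in> kernel" "src C m = rng C n" for m n
    using that by (simp add: kernel_def act_cmp)
  show "ginv C n \<in> kernel" if "n \<in> kernel" for n
    using that ginv_act by (force simp: kernel_def)
  show "cmp C (cmp C g n) (ginv C g) \<in> kernel"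
    if g: "g \<in> carrier C" and n: "n \<in> kernel" "src C g = rng C n" for g n
  proof -
    have "act (cmp C g (cmp C n (ginv C g))) y = y" if y: "y \<in> X (rng C g)" for y
    proof -
      have z: "act (ginv C g) y \<in> X (src C g)" using act_closed[of "ginv C g" y] g y by simp
      have "act (cmp C g (cmp C n (ginv C g))) y = act g (act n (act (ginv C g) y))"
        using g n y by (simp add: kernel_def act_cmp)
      also have "\<dots> = act g (act (ginv C g) y)"
        using n z by (simp add: kernel_def)
      finally show ?thesis using act_ginv g y by simp
    qed
    with g n show ?thesis by (simp add: kernel_def)
  qed
qed

text \<open>
  The two quotients of parallel arrows are the forms that relators take, so this turns a relation
  satisfied by the action into a relator in the kernel.
\<close>

lemma quotient_in_kernel:
  assumes p: "p \<in> carrier C" and p': "p' \<in> carrier C"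
    and pp': "src C p = src C p'" "rng C p = rng C p'"
    and eq: "\<And>y. y \<in> X (src C p) \<Longrightarrow> act p y = act p' y"
  shows "cmp C p (ginv C p') \<in> kernel" "cmp C (ginv C p) p' \<in> kernel"
proof -
  have "act (cmp C p (ginv C p')) y = y" if y: "y \<in> X (rng C p)" for y
  proof -
    have "act (ginv C p') y \<in> X (src C p)" using act_closed[of "ginv C p'" y] y p' pp' by simp
    then show ?thesis using eq act_ginv[OF p'] act_cmp[OF p, of "ginv C p'"] y p' pp' by simp
  qed
  moreover have "act (cmp C (ginv C p) p') y = y" if y: "y \<in> X (src C p)" for y
    using eq[OF y] ginv_act[OF p y] act_cmp[of "ginv C p" p' y] y p p' pp' by simp
  ultimately show "cmp C p (ginv C p') \<in> kernel" "cmp C (ginv C p) p' \<in> kernel"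
    using p p' pp' by (simp_all add: kernel_def)
qed

text \<open>
  If the generators act trivially, so does the whole normal family, because the kernel is a
  normal family. Hence the action depends only on cosets.
\<close>

lemma act_eq_if_coset_eq:
  assumes S: "S \<subseteq> kernel"
    and p: "p \<in> carrier C" and p': "p' \<in> carrier C"
    and eq: "left_coset C (normal_family_generated C S) p = left_coset C (normal_family_generated C S) p'"
    and y: "y \<in> X (src C p)"
  shows "act p y = act p' y"
proof -
  have "S \<subseteq> {n \<in> carrier C. src C n = rng C n}" using S by (auto simp: kernel_def)
  then interpret normal_quotient C "normal_family_generated C S"
    by unfold_locales (rule normal_family_generated)
  have pp': "src C p = src C p'" "rng C p = rng C p'"
    and N: "cmp C (ginv C p) p' \<in> normal_family_generated C S"
    using eq p p' by (simp_all add: coset_eq_iff)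
  from N have "cmp C (ginv C p) p' \<in> kernel"
    using normal_family_generated_least[OF normal_family_kernel S] by auto
  then have "act (cmp C (ginv C p) p') y = y" using p p' pp' y by (simp add: kernel_def)
  then have "act p y = act (cmp C p (cmp C (ginv C p) p')) y"
    using p p' pp' y by (subst act_cmp) auto
  with p p' pp' show ?thesis by simp
qed

end


section \<open>The path groupoid\<close>

lemma letter_inv_letter_inv [simp]: "letter_inv (letter_inv l) = l"
  by (cases l) simp

lemma letter_rng_inv [simp]: "letter_rng \<Gamma> (letter_inv l) = letter_src \<Gamma> l"
  and letter_src_inv [simp]: "letter_src \<Gamma> (letter_inv l) = letter_rng \<Gamma> l"
  and fst_letter_inv [simp]: "fst (letter_inv l) = fst l"
  by (cases l; simp)+

lemma reduced_word_simps [simp]: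
  "reduced_word []"
  "reduced_word (l # w) \<longleftrightarrow> reduced_word w \<and> (w = [] \<or> hd w \<noteq> letter_inv l)"
  by (auto simp: reduced_word_def successively_Cons)

lemma reduced_push_letter: "reduced_word w \<Longrightarrow> reduced_word (push_letter l w)"
  by (cases w) auto

lemma push_letter_reduced: "reduced_word (l # w) \<Longrightarrow> push_letter l w = l # w"
  by (cases w) auto

text \<open>
  Pushing a letter is a permutation of the reduced words. This makes the product of reduced words
  associative: it turns words into compositions of permutations.
\<close>

lemma push_letter_inverse: "reduced_word w \<Longrightarrow> push_letter l (push_letter (letter_inv l) w) = w"
  by (cases w) (auto simp: push_letter_reduced)

lemma reduced_foldr_push: "reduced_word v \<Longrightarrow> reduced_word (foldr push_letter w v)"
  by (induction w) (auto intro: reduced_push_letter)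

lemma foldr_push_letter:
  assumes "reduced_word v"
  shows "foldr push_letter (push_letter l w) v = push_letter l (foldr push_letter w v)"
  using assms by (cases w) (auto simp: push_letter_inverse reduced_foldr_push)

lemma foldr_push_assoc:
  assumes "reduced_word v"
  shows "foldr push_letter (foldr push_letter w w') v = foldr push_letter w (foldr push_letter w' v)"
  using assms by (induction w) (auto simp: foldr_push_letter)

lemma foldr_push_Nil: "reduced_word w \<Longrightarrow> foldr push_letter w [] = w"
  by (induction w) (auto simp: push_letter_reduced simp del: push_letter.simps)

definition letter_path :: "('v, 'e) pre_digraph \<Rightarrow> 'e \<times> bool \<Rightarrow> 'v \<times> ('e \<times> bool) list" where
  "letter_path \<Gamma> l = (letter_rng \<Gamma> l, [l])"

lemma edge_path_eq: "edge_path \<Gamma> e = letter_path \<Gamma> (e, True)"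
  by (simp add: edge_path_def letter_path_def)

lemma path_simps:
  "src (path_groupoid \<Gamma>) (x, w) = (word_src \<Gamma> x w, [])"
  "rng (path_groupoid \<Gamma>) (x, w) = (x, [])"
  "cmp (path_groupoid \<Gamma>) (x, w) (y, v) = (x, foldr push_letter w v)"
  "(x, w) \<in> carrier (path_groupoid \<Gamma>) \<longleftrightarrow> composable_word \<Gamma> x w \<and> reduced_word w"
  by (auto simp: path_groupoid_def)

context wf_digraph
begin

abbreviation Path where "Path \<equiv> path_groupoid G"

lemma letter_rng_in_verts: "fst l \<in> arcs G \<Longrightarrow> letter_rng G l \<in> verts G"
  by (cases l) simp

lemma composable_rng_in_verts: "composable_word G x w \<Longrightarrow> x \<in> verts G"
  by (cases w) (auto simp: letter_rng_in_verts)

lemma composable_src_in_verts: "composable_word G x w \<Longrightarrow> word_src G x w \<in> verts G"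
  by (induction w arbitrary: x) auto

lemma composable_push_letter:
  assumes "fst l \<in> arcs G" "composable_word G (letter_src G l) w"
  shows "composable_word G (letter_rng G l) (push_letter l w) \<and>
    word_src G (letter_rng G l) (push_letter l w) = word_src G (letter_src G l) w"
  using assms by (cases w) auto

lemma composable_foldr_push:
  "\<lbrakk>composable_word G x w; composable_word G (word_src G x w) v\<rbrakk> \<Longrightarrow>
    composable_word G x (foldr push_letter w v) \<and>
    word_src G x (foldr push_letter w v) = word_src G (word_src G x w) v"
proof (induction w arbitrary: x)
  case (Cons l w)
  then show ?case using composable_push_letter[of l "foldr push_letter w v"] by auto
qed simp

lemma obj_path: "obj Path = (\<lambda>x. (x, [])) ` verts G"
proof
  show "obj Path \<subseteq> (\<lambda>x. (x, [])) ` verts G"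
    by (auto simp: obj_def path_simps composable_src_in_verts)
  show "(\<lambda>x. (x, [])) ` verts G \<subseteq> obj Path"
  proof clarify
    fix x assume "x \<in> verts G"
    then have "src Path (x, []) \<in> obj Path" unfolding obj_def by (intro imageI) (simp add: path_simps)
    then show "(x, []) \<in> obj Path" by (simp add: path_simps)
  qed
qed

lemma letter_path_closed: "fst l \<in> arcs G \<Longrightarrow> letter_path G l \<in> carrier Path"
  by (cases l) (auto simp: letter_path_def path_simps)

lemma src_letter_path: "src Path (letter_path G l) = (letter_src G l, [])"
  and rng_letter_path: "rng Path (letter_path G l) = (letter_rng G l, [])"
  by (simp_all add: letter_path_def path_simps)

lemma edge_path_simps [simp]:
  "e \<in> arcs G \<Longrightarrow> edge_path G e \<in> carrier Path"
  "src Path (edge_path G e) = (tail G e, [])"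
  "rng Path (edge_path G e) = (head G e, [])"
  by (simp_all add: edge_path_eq letter_path_closed src_letter_path rng_letter_path)

lemma small_category_path: "small_category Path"
proof
  fix g assume g: "g \<in> carrier Path"
  obtain x w where [simp]: "g = (x, w)" by (cases g)
  show "src Path g \<in> carrier Path" "rng Path g \<in> carrier Path"
    "src Path (src Path g) = src Path g" "rng Path (src Path g) = src Path g"
    "src Path (rng Path g) = rng Path g" "rng Path (rng Path g) = rng Path g"
    "cmp Path (rng Path g) g = g" "cmp Path g (src Path g) = g"
    using g by (auto simp: path_simps composable_src_in_verts foldr_push_Nil dest: composable_rng_in_verts)
next
  fix g h assume g: "g \<in> carrier Path" and h: "h \<in> carrier Path" and gh: "src Path g = rng Path h"
  obtain x w y v where [simp]: "g = (x, w)" "h = (y, v)" by (cases g, cases h)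
  show "cmp Path g h \<in> carrier Path" "src Path (cmp Path g h) = src Path h"
    "rng Path (cmp Path g h) = rng Path g"
    using g h gh composable_foldr_push[of x w v] by (auto simp: path_simps reduced_foldr_push)
  fix k assume "k \<in> carrier Path"
  then show "cmp Path (cmp Path g h) k = cmp Path g (cmp Path h k)"
    by (cases k) (auto simp: path_simps foldr_push_assoc)
qed

lemma cmp_letter_path:
  assumes "(x, l # w) \<in> carrier Path"
  shows "(x, l # w) = cmp Path (letter_path G l) (letter_src G l, w)"
    and "(letter_src G l, w) \<in> carrier Path" and "fst l \<in> arcs G" and "letter_rng G l = x"
  using assms by (auto simp: path_simps letter_path_def push_letter_reduced)

lemma is_inverse_letter_path:
  "fst l \<in> arcs G \<Longrightarrow> is_inverse Path (letter_path G l) (letter_path G (letter_inv l))"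
  using letter_path_closed[of "letter_inv l"]
  by (simp add: is_inverse_def src_letter_path rng_letter_path) (simp add: letter_path_def path_simps)

text \<open>Only letters need explicit inverses; a word is a product of letters.\<close>

lemma small_groupoid_path: "small_groupoid Path"
proof -
  interpret small_category Path by (rule small_category_path)
  have "(x, w) \<in> carrier Path \<Longrightarrow> \<exists>h. is_inverse Path (x, w) h" for x w
  proof (induction w arbitrary: x)
    case Nil
    then have "is_inverse Path (x, []) (x, [])" by (simp add: is_inverse_def path_simps)
    then show ?case ..
  next
    case (Cons l w)
    note l = cmp_letter_path[OF Cons.prems]
    from Cons.IH[OF l(2)] obtain h where "is_inverse Path (letter_src G l, w) h" ..
    then have "is_inverse Path (cmp Path (letter_path G l) (letter_src G l, w))
        (cmp Path h (letter_path G (letter_inv l)))"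
      using is_inverse_cmp[OF letter_path_closed l(2) _ is_inverse_letter_path] l(3)
      by (simp add: src_letter_path path_simps)
    then show ?case unfolding l(1)[symmetric] ..
  qed
  then show ?thesis by unfold_locales auto
qed

sublocale path: small_groupoid Path
  by (rule small_groupoid_path)

lemma ginv_letter_path: "fst l \<in> arcs G \<Longrightarrow> ginv Path (letter_path G l) = letter_path G (letter_inv l)"
  by (simp add: path.ginv_eqI letter_path_closed is_inverse_letter_path)

text \<open>
  The rule for words, with a letter written as an edge or the inverse of an edge. Edges are put on
  the left, the end at which they act last.
\<close>

lemma path_induct [consumes 1, case_names object edge inverse_edge]:
  assumes "p \<in> carrier Path"
    and "\<And>x. x \<in> verts G \<Longrightarrow> H (x, [])"
    and edge: "\<And>e p. \<lbrakk>e \<in> arcs G; p \<in> carrier Path; rng Path p = (tail G e, []); H p\<rbrakk> \<Longrightarrow>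
      H (cmp Path (edge_path G e) p)"
    and inv: "\<And>e p. \<lbrakk>e \<in> arcs G; p \<in> carrier Path; rng Path p = (head G e, []); H p\<rbrakk> \<Longrightarrow>
      H (cmp Path (ginv Path (edge_path G e)) p)"
  shows "H p"
proof -
  have "(x, w) \<in> carrier Path \<Longrightarrow> H (x, w)" for x w
  proof (induction w arbitrary: x)
    case Nil
    then show ?case using assms(2) by (simp add: path_simps)
  next
    case (Cons l w)
    note l = cmp_letter_path[OF Cons.prems]
    obtain e b where eb: "l = (e, b)" by (cases l)
    show ?case
      unfolding l(1)
      using Cons.IH[OF l(2)] l(2,3) edge[of e] inv[of e] eb ginv_letter_path[of "(e, True)"]
      by (cases b) (auto simp: edge_path_eq path_simps)
  qed
  then show ?thesis using assms(1) by (cases p) simp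
qed

end


section \<open>Paths acting through bijections on edges\<close>

text \<open>
  The path groupoid is free: bijections \<open>T e\<close> from the set over the tail of \<open>e\<close> to the set over
  its head extend to an action of all paths.
\<close>

locale edge_action = wf_digraph G for G :: "('v, 'e) pre_digraph" +
  fixes X :: "'v \<Rightarrow> 'y set" and T :: "'e \<Rightarrow> 'y \<Rightarrow> 'y"
  assumes bij_T: "e \<in> arcs G \<Longrightarrow> bij_betw (T e) (X (tail G e)) (X (head G e))"
begin

definition letter_map :: "'e \<times> bool \<Rightarrow> 'y \<Rightarrow> 'y" where
  "letter_map l = (if snd l then T (fst l) else inv_into (X (tail G (fst l))) (T (fst l)))"

definition path_map :: "'v \<times> ('e \<times> bool) list \<Rightarrow> 'y \<Rightarrow> 'y" where
  "path_map p = foldr letter_map (snd p)"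

lemma letter_map_closed:
  "\<lbrakk>fst l \<in> arcs G; y \<in> X (letter_src G l)\<rbrakk> \<Longrightarrow> letter_map l y \<in> X (letter_rng G l)"
  using bij_betwE[OF bij_T] bij_betwE[OF bij_betw_inv_into[OF bij_T]]
  by (cases l) (auto simp: letter_map_def)

lemma letter_map_inverse:
  "\<lbrakk>fst l \<in> arcs G; y \<in> X (letter_rng G l)\<rbrakk> \<Longrightarrow> letter_map l (letter_map (letter_inv l) y) = y"
  using bij_betw_inv_into_right[OF bij_T] bij_betw_inv_into_left[OF bij_T]
  by (cases l) (auto simp: letter_map_def)

lemma foldr_letter_map_closed:
  "\<lbrakk>composable_word G x w; y \<in> X (word_src G x w)\<rbrakk> \<Longrightarrow> foldr letter_map w y \<in> X x"
proof (induction w arbitrary: x)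
  case (Cons l w)
  then show ?case using letter_map_closed[of l "foldr letter_map w y"] by auto
qed simp

text \<open>If the new letter cancels, both sides agree because inverse letters act by inverse bijections.\<close>

lemma foldr_letter_map_push:
  assumes l: "fst l \<in> arcs G" and w: "composable_word G (letter_src G l) w"
    and y: "y \<in> X (word_src G (letter_src G l) w)"
  shows "foldr letter_map (push_letter l w) y = letter_map l (foldr letter_map w y)"
proof (cases w)
  case (Cons m v)
  show ?thesis
  proof (cases "m = letter_inv l")
    case True
    with Cons w y have "foldr letter_map v y \<in> X (letter_rng G l)"
      by (intro foldr_letter_map_closed) auto
    with True Cons show ?thesis using letter_map_inverse[OF l] by simp
  qed (simp add: Cons)
qed simp

lemma foldr_letter_map_foldr_push:
  "\<lbrakk>composable_word G x w; composable_word G (word_src G x w) v; y \<in> X (word_src G (word_src G x w) v)\<rbrakk>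
    \<Longrightarrow> foldr letter_map (foldr push_letter w v) y = foldr letter_map w (foldr letter_map v y)"
proof (induction w arbitrary: x)
  case (Cons l w)
  then show ?case
    using foldr_letter_map_push[of l "foldr push_letter w v" y]
      composable_foldr_push[of "letter_src G l" w v] by auto
qed simp

sublocale path_action: groupoid_set_action Path "\<lambda>p. X (fst p)" path_map
proof
  show "path_map g y \<in> X (fst (rng Path g))" if "g \<in> carrier Path" "y \<in> X (fst (src Path g))" for g y
    using that foldr_letter_map_closed by (cases g) (auto simp: path_map_def path_simps)
  show "path_map (cmp Path g h) y = path_map g (path_map h y)"
    if "g \<in> carrier Path" "h \<in> carrier Path" "src Path g = rng Path h" "y \<in> X (fst (src Path h))"
    for g h y
    using that foldr_letter_map_foldr_push
    by (cases g, cases h) (auto simp: path_map_def path_simps)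
  show "path_map x y = y" if "x \<in> obj Path" for x y
    using that by (auto simp: obj_path path_map_def)
qed

lemma path_map_edge: "path_map (edge_path G e) = T e"
  by (simp add: path_map_def edge_path_def letter_map_def fun_eq_iff)

lemma continuous_path_map:
  assumes T: "\<And>e. e \<in> arcs G \<Longrightarrow>
      homeomorphic_map (subtopology Y (X (tail G e))) (subtopology Y (X (head G e))) (T e)"
    and X: "\<And>x. x \<in> verts G \<Longrightarrow> X x \<subseteq> topspace Y"
    and p: "p \<in> carrier Path"
  shows "continuous_map (subtopology Y (X (fst (src Path p))))
    (subtopology Y (X (fst (rng Path p)))) (path_map p)"
  using p
proof (induction rule: path_induct)
  case (object x)
  then show ?case by (simp add: path_simps path_map_def id_def[symmetric])
next
  case (edge e p)
  have "continuous_map (subtopology Y (X (fst (src Path p)))) (subtopology Y (X (head G e))) (T e \<circ> path_map p)"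
    using edge.IH edge.hyps(3) homeomorphic_imp_continuous_map[OF T[OF edge.hyps(1)]]
    by (simp add: continuous_map_compose)
  then have "continuous_map (subtopology Y (X (fst (src Path p)))) (subtopology Y (X (head G e)))
      (path_map (cmp Path (edge_path G e) p))"
    by (rule continuous_map_eq)
      (use edge.hyps in \<open>simp add: path_action.act_cmp path_map_edge\<close>)
  then show ?case using edge.hyps by simp
next
  case (inverse_edge e p)
  let ?i = "ginv Path (edge_path G e)"
  obtain f where f: "homeomorphic_maps (subtopology Y (X (tail G e))) (subtopology Y (X (head G e))) (T e) f"
    using T[OF inverse_edge.hyps(1)] homeomorphic_map_maps by blast
  have "continuous_map (subtopology Y (X (head G e))) (subtopology Y (X (tail G e))) f"
    using f by (simp add: homeomorphic_maps_def)
  then have "continuous_map (subtopology Y (X (head G e))) (subtopology Y (X (tail G e))) (path_map ?i)"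
  proof (rule continuous_map_eq)
    fix y assume "y \<in> topspace (subtopology Y (X (head G e)))"
    then have "T e (f y) = y" "f y \<in> X (tail G e)"
      using f by (auto simp: homeomorphic_maps_def continuous_map_def)
    then show "f y = path_map ?i y"
      using path_action.ginv_act[of "edge_path G e" "f y"] inverse_edge.hyps(1) by (simp add: path_map_edge)
  qed
  then have "continuous_map (subtopology Y (X (fst (src Path p)))) (subtopology Y (X (tail G e)))
      (path_map ?i \<circ> path_map p)"
    using inverse_edge.IH inverse_edge.hyps(3) by (simp add: continuous_map_compose)
  then have "continuous_map (subtopology Y (X (fst (src Path p)))) (subtopology Y (X (tail G e)))
      (path_map (cmp Path ?i p))"
    by (rule continuous_map_eq)
      (use inverse_edge.hyps in \<open>simp add: path_action.act_cmp\<close>)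
  then show ?case using inverse_edge.hyps by simp
qed

end

section \<open>Continuity on products with a discrete space\<close>

lemma continuous_map_discrete_prod_iff:
  "continuous_map (subtopology (prod_topology (discrete_topology A) Y) D) Z f \<longleftrightarrow>
    (\<forall>a\<in>A. continuous_map (subtopology Y {y. (a, y) \<in> D}) Z (\<lambda>y. f (a, y)))"
  (is "?L \<longleftrightarrow> ?R")
proof
  assume L: ?L
  show ?R
  proof
    fix a assume "a \<in> A"
    then have "continuous_map (subtopology Y {y. (a, y) \<in> D})
        (subtopology (prod_topology (discrete_topology A) Y) D) (Pair a)"
      by (auto simp: continuous_map_in_subtopology continuous_map_pairwise o_def
          intro: continuous_map_from_subtopology)
    from continuous_map_compose[OF this L]
    show "continuous_map (subtopology Y {y. (a, y) \<in> D}) Z (\<lambda>y. f (a, y))" by (simp add: o_def)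
  qed
next
  assume R: ?R
  let ?X = "subtopology (prod_topology (discrete_topology A) Y) D"
  show ?L
  proof (rule pasting_lemma[where I = A and T = "\<lambda>a. ({a} \<times> topspace Y) \<inter> D"
        and f = "\<lambda>a z. f (a, snd z)"])
    fix a assume a: "a \<in> A"
    then show "openin ?X (({a} \<times> topspace Y) \<inter> D)"
      by (intro openin_subtopology_Int) (simp add: openin_prod_Times_iff)
    have "continuous_map (subtopology ?X ({a} \<times> topspace Y \<inter> D)) (subtopology Y {y. (a, y) \<in> D}) snd"
      by (auto simp: continuous_map_in_subtopology
          intro!: continuous_map_from_subtopology continuous_map_snd)
    from continuous_map_compose[OF this R[rule_format, OF a]]
    show "continuous_map (subtopology ?X ({a} \<times> topspace Y \<inter> D)) Z (\<lambda>z. f (a, snd z))"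
      by (simp add: o_def)
  qed (auto simp: topspace_subtopology)
qed

lemma open_map_discrete_prod:
  assumes "\<And>a. a \<in> A \<Longrightarrow> open_map Y Z (\<lambda>y. f (a, y))"
  shows "open_map (prod_topology (discrete_topology A) Y) Z f"
  unfolding open_map_def
proof (intro allI impI)
  fix W assume W: "openin (prod_topology (discrete_topology A) Y) W"
  have slice: "openin Y {y \<in> topspace Y. (a, y) \<in> W}" if a: "a \<in> A" for a
  proof -
    have "continuous_map Y (prod_topology (discrete_topology A) Y) (Pair a)"
      using a by (auto simp: continuous_map_pairwise o_def)
    from openin_continuous_map_preimage[OF this W] show ?thesis .
  qed
  have "f ` W = (\<Union>a\<in>A. (\<lambda>y. f (a, y)) ` {y \<in> topspace Y. (a, y) \<in> W})"
    using openin_subset[OF W] by (force simp: image_iff)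
  also have "openin Z \<dots>"
    using assms slice unfolding open_map_def by blast
  finally show "openin Z (f ` W)" .
qed

lemma open_map_slice:
  assumes f: "open_map (prod_topology (discrete_topology A) Y) Z f" and a: "a \<in> A"
  shows "open_map Y Z (\<lambda>y. f (a, y))"
  unfolding open_map_def
proof (intro allI impI)
  fix W assume "openin Y W"
  then have "openin (prod_topology (discrete_topology A) Y) ({a} \<times> W)"
    using a by (simp add: openin_prod_Times_iff)
  with f have "openin Z (f ` ({a} \<times> W))" by (simp add: open_map_def)
  moreover have "f ` ({a} \<times> W) = (\<lambda>y. f (a, y)) ` W" by auto
  ultimately show "openin Z ((\<lambda>y. f (a, y)) ` W)" by simp
qed

lemma continuous_map_into_discrete_iff:
  "continuous_map Y (discrete_topology A) f \<longleftrightarrow>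
    f ` topspace Y \<subseteq> A \<and> (\<forall>a\<in>A. openin Y {y \<in> topspace Y. f y = a})" (is "?L \<longleftrightarrow> ?R")
proof
  assume L: ?L
  have "openin Y {y \<in> topspace Y. f y = a}" if "a \<in> A" for a
    using openin_continuous_map_preimage[OF L, of "{a}"] that by simp
  then show ?R using continuous_map_image_subset_topspace[OF L] by simp
next
  assume R: ?R
  have "openin Y {y \<in> topspace Y. f y \<in> V}" if "V \<subseteq> A" for V
  proof -
    have "{y \<in> topspace Y. f y \<in> V} = (\<Union>a\<in>V. {y \<in> topspace Y. f y = a})" by auto
    also have "openin Y \<dots>" using R that by (intro openin_Union) auto
    finally show ?thesis .
  qed
  with R show ?L by (auto simp: continuous_map_def)
qed


section \<open>Discrete groupoids and their actions\<close>

lemma discrete_groupoid_simps [simp]: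
  "carrier (discrete_groupoid U) = carrier U"
  "src (discrete_groupoid U) = src U"
  "rng (discrete_groupoid U) = rng U"
  "cmp (discrete_groupoid U) = cmp U"
  "obj (discrete_groupoid U) = obj U"
  "ginv (discrete_groupoid U) = ginv U"
  "arrow_top (discrete_groupoid U) = discrete_topology (carrier U)"
  by (auto simp: discrete_groupoid_def cat.extend_def obj_def ginv_def is_inverse_def fun_eq_iff)

lemma local_homeomorphism_map_discrete:
  assumes "f ` A \<subseteq> B"
  shows "local_homeomorphism_map (discrete_topology A) (discrete_topology B) f"
  unfolding local_homeomorphism_map_def
proof
  fix x assume "x \<in> topspace (discrete_topology A)"
  then have x: "x \<in> A" "f x \<in> B" using assms by auto
  then have "homeomorphic_map (discrete_topology {x}) (discrete_topology {f x}) f"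
    by (auto simp: homeomorphic_map_def quotient_map_def)
  with x show "\<exists>V. x \<in> V \<and> openin (discrete_topology A) V \<and> openin (discrete_topology B) (f ` V) \<and>
      homeomorphic_map (subtopology (discrete_topology A) V)
        (subtopology (discrete_topology B) (f ` V)) f"
    by (intro exI[of _ "{x}"]) (simp add: subtopology_discrete_topology)
qed

lemma etale_discrete_groupoid:
  assumes "small_groupoid U"
  shows "etale_groupoid (discrete_groupoid U)"
proof -
  interpret U: small_groupoid U by fact
  have 1: "carrier U \<inter> obj U = obj U" using U.obj_closed by auto
  show ?thesis
  proof
  qed (use U.inverse_exists in \<open>auto simp: is_inverse_def subtopology_discrete_topology 1
        U.src_in_obj U.rng_in_obj prod_topology_discrete_topology[symmetric]
        intro!: local_homeomorphism_map_discrete\<close>)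
qed

text \<open>
  The domain of the multiplication map is a disjoint union of open slices, one for each arrow, and
  the objects form a discrete space. So the topological conditions can be checked on one arrow and
  on one fibre of the anchor map at a time.
\<close>

lemma groupoid_actions_discrete:
  assumes "small_category U"
  shows "(\<rho>, m) \<in> groupoid_actions (discrete_groupoid U) Y \<longleftrightarrow>
     \<rho> \<in> extensional (topspace Y) \<and>
     (\<forall>g y. \<not> (g \<in> carrier U \<and> y \<in> topspace Y \<and> src U g = \<rho> y) \<longrightarrow> m g y = undefined) \<and>
     \<rho> ` topspace Y \<subseteq> obj U \<and>
     (\<forall>x\<in>obj U. openin Y {y \<in> topspace Y. \<rho> y = x}) \<and>
     (\<forall>g\<in>carrier U. continuous_map (subtopology Y {y. src U g = \<rho> y}) Y (m g)) \<and>
     (\<forall>g\<in>carrier U. \<forall>y\<in>topspace Y. src U g = \<rho> y \<longrightarrow> \<rho> (m g y) = rng U g) \<and>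
     (\<forall>g\<in>carrier U. \<forall>h\<in>carrier U. \<forall>y\<in>topspace Y. src U g = rng U h \<longrightarrow> src U h = \<rho> y \<longrightarrow>
        m g (m h y) = m (cmp U g h) y) \<and>
     (\<forall>y\<in>topspace Y. m (\<rho> y) y = y)"
proof -
  have "carrier U \<inter> obj U = obj U" using small_category.obj_closed[OF assms] by auto
  then show ?thesis
    by (simp add: groupoid_actions_def subtopology_discrete_topology
        continuous_map_into_discrete_iff continuous_map_discrete_prod_iff)
qed

section \<open>The groupoid of a diagram\<close>

type_synonym ('c, 'b) presented_arrow = "('c \<times> (('c + 'c \<times> 'b) \<times> bool) list) set"

locale plain_group_diagram = group_diagram_data C G \<phi> u
  for C :: "'c cat" and G :: "'c \<Rightarrow> 'b monoid" and \<phi> u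
begin

abbreviation \<Gamma> where "\<Gamma> \<equiv> data_graph C G"
abbreviation P where "P \<equiv> path_groupoid \<Gamma>"
abbreviation arrow where "arrow g \<equiv> edge_path \<Gamma> (Inl g)"
abbreviation loop where "loop x \<gamma> \<equiv> edge_path \<Gamma> (Inr (x, \<gamma>))"
abbreviation R where "R \<equiv> relators C G \<phi> u"
abbreviation U where "U \<equiv> presented_groupoid C G \<phi> u"
abbreviation q where "q \<equiv> left_coset P (normal_family_generated P R)"

lemma graph_simps [simp]:
  "verts \<Gamma> = obj C"
  "Inl g \<in> arcs \<Gamma> \<longleftrightarrow> g \<in> carrier C"
  "Inr (x, \<gamma>) \<in> arcs \<Gamma> \<longleftrightarrow> x \<in> obj C \<and> \<gamma> \<in> carrier (G x)"
  "tail \<Gamma> (Inl g) = src C g" "tail \<Gamma> (Inr (x, \<gamma>)) = x"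
  "head \<Gamma> (Inl g) = rng C g" "head \<Gamma> (Inr (x, \<gamma>)) = x"
  by (auto simp: data_graph_def)

sublocale wf_digraph \<Gamma>
  by unfold_locales (auto simp: data_graph_def src_in_obj rng_in_obj)

lemma group_src: "g \<in> carrier C \<Longrightarrow> group (G (src C g))"
  and group_rng: "g \<in> carrier C \<Longrightarrow> group (G (rng C g))"
  by (simp_all add: groups src_in_obj rng_in_obj)

lemma group_hom_\<phi>: "g \<in> carrier C \<Longrightarrow> group_hom (G (rng C g)) (G (src C g)) (\<phi> g)"
  by (simp add: group_hom_def group_hom_axioms_def group_src group_rng homs)

lemma \<phi>_closed: "\<lbrakk>g \<in> carrier C; \<gamma> \<in> carrier (G (rng C g))\<rbrakk> \<Longrightarrow> \<phi> g \<gamma> \<in> carrier (G (src C g))"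
  by (rule group_hom.hom_closed[OF group_hom_\<phi>])

lemma \<phi>_one: "g \<in> carrier C \<Longrightarrow> \<phi> g \<one>\<^bsub>G (rng C g)\<^esub> = \<one>\<^bsub>G (src C g)\<^esub>"
  by (rule group_hom.hom_one[OF group_hom_\<phi>])

lemma mult_closed: "\<lbrakk>x \<in> obj C; \<gamma> \<in> carrier (G x); \<gamma>' \<in> carrier (G x)\<rbrakk> \<Longrightarrow> \<gamma> \<otimes>\<^bsub>G x\<^esub> \<gamma>' \<in> carrier (G x)"
  by (simp add: groups group.is_monoid monoid.m_closed)

lemma one_closed: "x \<in> obj C \<Longrightarrow> \<one>\<^bsub>G x\<^esub> \<in> carrier (G x)"
  by (simp add: groups group.is_monoid monoid.one_closed)

lemma object_path: "x \<in> obj C \<Longrightarrow> (x, []) \<in> obj P"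
  and object_path_closed [simp]: "x \<in> obj C \<Longrightarrow> (x, []) \<in> carrier P"
  by (auto simp: obj_path path_simps)

text \<open>
  The third kind of relators is regrouped as \<open>p\<inverse> p'\<close> for two parallel paths. Since the first two
  kinds have the form \<open>p p'\<inverse>\<close>, each of them states an equation between two paths in the quotient.
\<close>

lemma relators_eq:
  "R =
     {cmp P (cmp P (loop x \<gamma>\<^sub>1) (loop x \<gamma>\<^sub>2)) (ginv P (loop x (\<gamma>\<^sub>1 \<otimes>\<^bsub>G x\<^esub> \<gamma>\<^sub>2))) |x \<gamma>\<^sub>1 \<gamma>\<^sub>2.
        x \<in> obj C \<and> \<gamma>\<^sub>1 \<in> carrier (G x) \<and> \<gamma>\<^sub>2 \<in> carrier (G x)} \<union>
     {cmp P (cmp P (cmp P (arrow g) (loop (src C g) (\<phi> g \<gamma>))) (ginv P (arrow g)))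
          (ginv P (loop (rng C g) \<gamma>)) |g \<gamma>.
        g \<in> carrier C \<and> \<gamma> \<in> carrier (G (rng C g))} \<union>
     {cmp P (ginv P (cmp P (arrow (cmp C g h)) (loop (src C h) (u g h))))
          (cmp P (arrow g) (arrow h)) |g h.
        g \<in> carrier C \<and> h \<in> carrier C \<and> src C g = rng C h} \<union>
     {arrow x |x. x \<in> obj C}"
proof -
  have "cmp P (cmp P (cmp P (ginv P (loop (src C h) (u g h))) (ginv P (arrow (cmp C g h))))
        (arrow g)) (arrow h)
      = cmp P (ginv P (cmp P (arrow (cmp C g h)) (loop (src C h) (u g h)))) (cmp P (arrow g) (arrow h))"
    if "g \<in> carrier C" "h \<in> carrier C" "src C g = rng C h" for g h
    using that by (simp add: u_closed src_in_obj)
  then show ?thesis unfolding relators_def Let_def by (intro arg_cong2[of _ _ _ _ "(\<union>)"] refl) (metis (lifting))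
qed

lemma relators_isotropy: "R \<subseteq> {n \<in> carrier P. src P n = rng P n}"
  unfolding relators_eq
  by (auto simp: mult_closed \<phi>_closed u_closed src_in_obj rng_in_obj obj_closed src_obj rng_obj)

sublocale quot: normal_quotient P "normal_family_generated P R"
  by unfold_locales (rule path.normal_family_generated[OF relators_isotropy])

lemma U_eq: "U = quotient_groupoid P (normal_family_generated P R)"
  by (simp add: presented_groupoid_def)

sublocale U: small_groupoid U
  unfolding U_eq by (rule quot.quotient_small_groupoid)

lemmas q_simps = quot.src_coset[folded U_eq] quot.rng_coset[folded U_eq] quot.cmp_coset[folded U_eq]
  quot.coset_closed[folded U_eq] quot.ginv_coset[folded U_eq]

lemma q_cmp: "\<lbrakk>p \<in> carrier P; p' \<in> carrier P; src P p = rng P p'\<rbrakk> \<Longrightarrow> q (cmp P p p') = cmp U (q p) (q p')"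
  by (simp add: q_simps)

lemma q_object_eq_iff: "\<lbrakk>x \<in> obj C; y \<in> obj C\<rbrakk> \<Longrightarrow> q (x, []) = q (y, []) \<longleftrightarrow> x = y"
  by (simp add: quot.coset_obj_eq_iff object_path)

lemma carrier_U: "carrier U = q ` carrier P"
  by (simp add: U_eq quot.carrier_Q)

lemma obj_U: "obj U = (\<lambda>x. q (x, [])) ` obj C"
  by (simp add: U_eq quot.obj_Q obj_path image_image)

definition A :: "'c \<Rightarrow> ('c, 'b) presented_arrow" where
  "A g = q (arrow g)"

definition L :: "'c \<Rightarrow> 'b \<Rightarrow> ('c, 'b) presented_arrow" where
  "L x \<gamma> = q (loop x \<gamma>)"

lemma A_simps [simp]:
  "g \<in> carrier C \<Longrightarrow> A g \<in> carrier U"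
  "g \<in> carrier C \<Longrightarrow> src U (A g) = q (src C g, [])"
  "g \<in> carrier C \<Longrightarrow> rng U (A g) = q (rng C g, [])"
  by (simp_all add: A_def q_simps)

lemma L_simps [simp]:
  "\<lbrakk>x \<in> obj C; \<gamma> \<in> carrier (G x)\<rbrakk> \<Longrightarrow> L x \<gamma> \<in> carrier U"
  "\<lbrakk>x \<in> obj C; \<gamma> \<in> carrier (G x)\<rbrakk> \<Longrightarrow> src U (L x \<gamma>) = q (x, [])"
  "\<lbrakk>x \<in> obj C; \<gamma> \<in> carrier (G x)\<rbrakk> \<Longrightarrow> rng U (L x \<gamma>) = q (x, [])"
  by (simp_all add: L_def q_simps)

lemma U_units [simp]:
  "\<lbrakk>B \<in> carrier U; src U B = D\<rbrakk> \<Longrightarrow> cmp U B D = B"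
  "\<lbrakk>B \<in> carrier U; rng U B = D\<rbrakk> \<Longrightarrow> cmp U D B = B"
  by auto

lemma relators_in_N: "R \<subseteq> normal_family_generated P R"
  by (rule generators_in_normal_family_generated)

lemma L_mult:
  assumes "x \<in> obj C" "\<gamma>\<^sub>1 \<in> carrier (G x)" "\<gamma>\<^sub>2 \<in> carrier (G x)"
  shows "cmp U (L x \<gamma>\<^sub>1) (L x \<gamma>\<^sub>2) = L x (\<gamma>\<^sub>1 \<otimes>\<^bsub>G x\<^esub> \<gamma>\<^sub>2)"
proof -
  have "cmp P (cmp P (loop x \<gamma>\<^sub>1) (loop x \<gamma>\<^sub>2)) (ginv P (loop x (\<gamma>\<^sub>1 \<otimes>\<^bsub>G x\<^esub> \<gamma>\<^sub>2))) \<in> R"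
    unfolding relators_eq using assms by blast
  then have "q (cmp P (loop x \<gamma>\<^sub>1) (loop x \<gamma>\<^sub>2)) = L x (\<gamma>\<^sub>1 \<otimes>\<^bsub>G x\<^esub> \<gamma>\<^sub>2)"
    unfolding L_def using relators_in_N assms mult_closed
    by (intro quot.coset_eqI_right) auto
  then show ?thesis using assms by (simp add: q_simps L_def)
qed

text \<open>The class of the unit of a group is idempotent, and the only idempotents of a groupoid are its objects.\<close>

lemma L_one:
  assumes x: "x \<in> obj C"
  shows "L x \<one>\<^bsub>G x\<^esub> = q (x, [])"
proof -
  let ?l = "L x \<one>\<^bsub>G x\<^esub>"
  have "cmp U ?l ?l = ?l"
    using x L_mult groups by (simp add: one_closed group.is_monoid)
  then show ?thesis
    using U.ginv_cmp_cancel[of ?l ?l] x by (simp add: one_closed)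
qed

lemma L_A:
  assumes g: "g \<in> carrier C" and \<gamma>: "\<gamma> \<in> carrier (G (rng C g))"
  shows "cmp U (L (rng C g) \<gamma>) (A g) = cmp U (A g) (L (src C g) (\<phi> g \<gamma>))"
proof -
  have "cmp P (cmp P (cmp P (arrow g) (loop (src C g) (\<phi> g \<gamma>))) (ginv P (arrow g)))
      (ginv P (loop (rng C g) \<gamma>)) \<in> R"
    unfolding relators_eq using assms by blast
  then have "q (cmp P (cmp P (arrow g) (loop (src C g) (\<phi> g \<gamma>))) (ginv P (arrow g))) = L (rng C g) \<gamma>"
    unfolding L_def using relators_in_N assms \<phi>_closed src_in_obj rng_in_obj
    by (intro quot.coset_eqI_right) auto
  then have "L (rng C g) \<gamma> = cmp U (cmp U (A g) (L (src C g) (\<phi> g \<gamma>))) (ginv U (A g))"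
    using assms \<phi>_closed by (simp add: q_simps L_def A_def src_in_obj)
  then show ?thesis
    using assms \<phi>_closed by (simp add: src_in_obj rng_in_obj)
qed

lemma A_mult:
  assumes "g \<in> carrier C" "h \<in> carrier C" "src C g = rng C h"
  shows "cmp U (A g) (A h) = cmp U (A (cmp C g h)) (L (src C h) (u g h))"
proof -
  have "cmp P (ginv P (cmp P (arrow (cmp C g h)) (loop (src C h) (u g h))))
      (cmp P (arrow g) (arrow h)) \<in> R"
    unfolding relators_eq using assms by blast
  then have "q (cmp P (arrow (cmp C g h)) (loop (src C h) (u g h))) = q (cmp P (arrow g) (arrow h))"
    using relators_in_N assms u_closed src_in_obj
    by (intro quot.coset_eqI_left) auto
  then show ?thesis
    using assms u_closed by (simp add: q_simps L_def A_def src_in_obj)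
qed

lemma A_obj:
  assumes "x \<in> obj C"
  shows "A x = q (x, [])"
proof -
  have "arrow x \<in> R"
    unfolding relators_eq using assms by blast
  then show ?thesis
    unfolding A_def using relators_in_N assms obj_closed
    by (intro quot.coset_eqI_right)
      (auto simp: src_obj rng_obj path.ginv_obj object_path path_simps edge_path_def)
qed

text \<open>The arrow that represents the element \<open>\<gamma>\<close> of the bimodule of \<open>g\<close>.\<close>

definition E :: "'c \<Rightarrow> 'b \<Rightarrow> ('c, 'b) presented_arrow" where
  "E g \<gamma> = cmp U (A g) (L (src C g) \<gamma>)"

lemma E_simps [simp]:
  assumes "g \<in> carrier C" "\<gamma> \<in> carrier (G (src C g))"
  shows "E g \<gamma> \<in> carrier U" "src U (E g \<gamma>) = q (src C g, [])" "rng U (E g \<gamma>) = q (rng C g, [])"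
  using assms by (simp_all add: E_def src_in_obj)

lemma E_one: "g \<in> carrier C \<Longrightarrow> E g \<one>\<^bsub>G (src C g)\<^esub> = A g"
  unfolding E_def using U.comp_src[of "A g"] by (simp add: L_one src_in_obj)

lemma E_obj: "\<lbrakk>x \<in> obj C; \<gamma> \<in> carrier (G x)\<rbrakk> \<Longrightarrow> E x \<gamma> = L x \<gamma>"
  unfolding E_def using U.comp_rng[of "L x \<gamma>"] by (simp add: A_obj src_obj)

text \<open>
  In the word \<open>g \<gamma>\<^sub>1 h \<gamma>\<^sub>2\<close>, the second kind of relators moves \<open>\<gamma>\<^sub>1\<close> past \<open>h\<close>, and the third kind
  replaces \<open>g h\<close> by the composite times \<open>u g h\<close>. The result is the multiplication map of the diagram.
\<close>

lemma E_mult: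
  assumes g: "g \<in> carrier C" and h: "h \<in> carrier C" and gh: "src C g = rng C h"
    and \<gamma>: "\<gamma>\<^sub>1 \<in> carrier (G (src C g))" "\<gamma>\<^sub>2 \<in> carrier (G (src C h))"
  shows "cmp U (E g \<gamma>\<^sub>1) (E h \<gamma>\<^sub>2) =
    E (cmp C g h) (u g h \<otimes>\<^bsub>G (src C h)\<^esub> \<phi> h \<gamma>\<^sub>1 \<otimes>\<^bsub>G (src C h)\<^esub> \<gamma>\<^sub>2)"
proof -
  have o: "src C h \<in> obj C" "rng C h \<in> obj C" using h by (simp_all add: src_in_obj rng_in_obj)
  have \<phi>: "\<phi> h \<gamma>\<^sub>1 \<in> carrier (G (src C h))" using assms \<phi>_closed by simp
  have uc: "u g h \<in> carrier (G (src C h))" using assms u_closed by simp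
  have "cmp U (E g \<gamma>\<^sub>1) (E h \<gamma>\<^sub>2) = cmp U (A g) (cmp U (cmp U (L (rng C h) \<gamma>\<^sub>1) (A h)) (L (src C h) \<gamma>\<^sub>2))"
    using assms o by (simp add: E_def)
  also have "\<dots> = cmp U (cmp U (A g) (A h)) (cmp U (L (src C h) (\<phi> h \<gamma>\<^sub>1)) (L (src C h) \<gamma>\<^sub>2))"
    using assms o \<phi> by (simp add: L_A)
  also have "\<dots> = cmp U (A (cmp C g h)) (cmp U (L (src C h) (u g h))
      (cmp U (L (src C h) (\<phi> h \<gamma>\<^sub>1)) (L (src C h) \<gamma>\<^sub>2)))"
    using assms o \<phi> uc by (simp add: A_mult)
  finally show ?thesis
    using assms o \<phi> uc by (simp add: E_def L_mult mult_closed groups group.is_monoid monoid.m_assoc)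
qed

text \<open>
  An arrow of the free groupoid is a word in the edges and their inverses. Hence a statement about
  arrows of the quotient that is stable under left multiplication by the generators and by their
  inverses only has to be checked on objects.
\<close>

lemma U_induct [consumes 1, case_names object arrow loop inverse_arrow inverse_loop]:
  assumes "B \<in> carrier U"
    and object: "\<And>x. x \<in> obj C \<Longrightarrow> H (q (x, []))"
    and arrow: "\<And>g B. \<lbrakk>g \<in> carrier C; B \<in> carrier U; rng U B = q (src C g, []); H B\<rbrakk> \<Longrightarrow>
      H (cmp U (A g) B)"
    and loop: "\<And>x \<gamma> B. \<lbrakk>x \<in> obj C; \<gamma> \<in> carrier (G x); B \<in> carrier U; rng U B = q (x, []); H B\<rbrakk> \<Longrightarrow>
      H (cmp U (L x \<gamma>) B)"
    and inverse_arrow: "\<And>g B. \<lbrakk>g \<in> carrier C; B \<in> carrier U; rng U B = q (rng C g, []); H B\<rbrakk> \<Longrightarrow>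
      H (cmp U (ginv U (A g)) B)"
    and inverse_loop: "\<And>x \<gamma> B. \<lbrakk>x \<in> obj C; \<gamma> \<in> carrier (G x); B \<in> carrier U; rng U B = q (x, []); H B\<rbrakk> \<Longrightarrow>
      H (cmp U (ginv U (L x \<gamma>)) B)"
  shows "H B"
proof -
  obtain p where p: "p \<in> carrier P" "B = q p" using assms(1) carrier_U by auto
  from p(1) have "H (q p)"
  proof (induction rule: path_induct)
    case (object x)
    then show ?case using assms(2) by simp
  next
    case (edge e p)
    then have "q (cmp P (edge_path \<Gamma> e) p) = cmp U (q (edge_path \<Gamma> e)) (q p)"
      by (intro q_cmp) auto
    moreover have "H (cmp U (q (edge_path \<Gamma> e)) (q p))"
    proof (cases e)
      case (Inl g)
      then show ?thesis using edge arrow[of g "q p"] by (simp add: A_def q_simps)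
    next
      case (Inr l)
      then show ?thesis using edge loop[of "fst l" "snd l" "q p"] by (cases l) (simp add: L_def q_simps)
    qed
    ultimately show ?case by simp
  next
    case (inverse_edge e p)
    then have "q (cmp P (ginv P (edge_path \<Gamma> e)) p) = cmp U (ginv U (q (edge_path \<Gamma> e))) (q p)"
      by (subst q_cmp) (auto simp: q_simps)
    moreover have "H (cmp U (ginv U (q (edge_path \<Gamma> e))) (q p))"
    proof (cases e)
      case (Inl g)
      then show ?thesis using inverse_edge inverse_arrow[of g "q p"] by (simp add: A_def q_simps)
    next
      case (Inr l)
      then show ?thesis
        using inverse_edge inverse_loop[of "fst l" "snd l" "q p"] by (cases l) (simp add: L_def q_simps)
    qed
    ultimately show ?case by simp
  qed
  then show ?thesis using p(2) by simp
qed


section \<open>From actions of the groupoid to actions of the diagram\<close>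

abbreviation F where "F \<equiv> diagram_of C G \<phi> u"
abbreviation DU where "DU \<equiv> discrete_groupoid U"

lemma diagram_simps [simp]:
  "shape F = C" "grp F = G" "corr F = (\<lambda>g. carrier (G (src C g)))"
  "ract F g \<xi> \<gamma> = \<xi> \<otimes>\<^bsub>G (src C g)\<^esub> \<gamma>"
  "cmult F g h \<gamma>\<^sub>1 \<gamma>\<^sub>2 = u g h \<otimes>\<^bsub>G (src C h)\<^esub> \<phi> h \<gamma>\<^sub>1 \<otimes>\<^bsub>G (src C h)\<^esub> \<gamma>\<^sub>2"
  by (simp_all add: diagram_of_def)

definition fibre :: "'y topology \<Rightarrow> ('y \<Rightarrow> ('c, 'b) presented_arrow) \<Rightarrow> 'c \<Rightarrow> 'y set" where
  "fibre Y \<rho> x = {y \<in> topspace Y. \<rho> y = q (x, [])}"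

definition \<Phi> ::
  "'y topology \<Rightarrow> (('c, 'b) presented_arrow, 'y) groupoid_action \<Rightarrow>
    ('c, 'b, 'y) diagram_action" where
  "\<Phi> Y = (\<lambda>(\<rho>, m). (restrict (fibre Y \<rho>) (obj C),
     \<lambda>g \<gamma> y. if g \<in> carrier C \<and> \<gamma> \<in> carrier (G (src C g)) \<and> y \<in> fibre Y \<rho> (src C g)
       then m (E g \<gamma>) y else undefined))"

lemma groupoid_actionsD:
  assumes "(\<rho>, m) \<in> groupoid_actions DU Y"
  shows "\<rho> \<in> extensional (topspace Y)"
    "\<And>g y. \<not> (g \<in> carrier U \<and> y \<in> topspace Y \<and> src U g = \<rho> y) \<Longrightarrow> m g y = undefined"
    "\<And>y. y \<in> topspace Y \<Longrightarrow> \<rho> y \<in> obj U"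
    "\<And>x. x \<in> obj U \<Longrightarrow> openin Y {y \<in> topspace Y. \<rho> y = x}"
    "\<And>g. g \<in> carrier U \<Longrightarrow> continuous_map (subtopology Y {y. src U g = \<rho> y}) Y (m g)"
    "\<And>g y. \<lbrakk>g \<in> carrier U; y \<in> topspace Y; src U g = \<rho> y\<rbrakk> \<Longrightarrow> \<rho> (m g y) = rng U g"
    "\<And>g h y. \<lbrakk>g \<in> carrier U; h \<in> carrier U; y \<in> topspace Y; src U g = rng U h; src U h = \<rho> y\<rbrakk> \<Longrightarrow>
        m g (m h y) = m (cmp U g h) y"
    "\<And>y. y \<in> topspace Y \<Longrightarrow> m (\<rho> y) y = y"
    "\<And>g y. \<lbrakk>g \<in> carrier U; y \<in> topspace Y; src U g = \<rho> y\<rbrakk> \<Longrightarrow> m g y \<in> topspace Y"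
proof -
  note * = assms[unfolded groupoid_actions_discrete[OF U.small_category_axioms]]
  show "\<rho> \<in> extensional (topspace Y)" using * by blast
  show "\<And>g y. \<not> (g \<in> carrier U \<and> y \<in> topspace Y \<and> src U g = \<rho> y) \<Longrightarrow> m g y = undefined"
    using * by blast
  show "\<And>y. y \<in> topspace Y \<Longrightarrow> \<rho> y \<in> obj U" using * by blast
  show "\<And>x. x \<in> obj U \<Longrightarrow> openin Y {y \<in> topspace Y. \<rho> y = x}" using * by blast
  show 2: "\<And>g. g \<in> carrier U \<Longrightarrow> continuous_map (subtopology Y {y. src U g = \<rho> y}) Y (m g)"
    using * by blast
  show "\<And>g y. \<lbrakk>g \<in> carrier U; y \<in> topspace Y; src U g = \<rho> y\<rbrakk> \<Longrightarrow> \<rho> (m g y) = rng U g"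
    using * by blast
  show "\<And>g h y. \<lbrakk>g \<in> carrier U; h \<in> carrier U; y \<in> topspace Y; src U g = rng U h; src U h = \<rho> y\<rbrakk> \<Longrightarrow>
        m g (m h y) = m (cmp U g h) y"
    using * by blast
  show "\<And>y. y \<in> topspace Y \<Longrightarrow> m (\<rho> y) y = y" using * by blast
  show "\<And>g y. \<lbrakk>g \<in> carrier U; y \<in> topspace Y; src U g = \<rho> y\<rbrakk> \<Longrightarrow> m g y \<in> topspace Y"
    using continuous_map_image_subset_topspace[OF 2] by (force simp: topspace_subtopology)
qed

text \<open>The inverse arrow translates back, and both translations are continuous.\<close>

lemma translation_homeomorphic_map:
  assumes act: "(\<rho>, m) \<in> groupoid_actions DU Y"
    and g: "g \<in> carrier U"
  shows "homeomorphic_map (subtopology Y {y \<in> topspace Y. \<rho> y = src U g})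
    (subtopology Y {y \<in> topspace Y. \<rho> y = rng U g}) (m g)"
proof -
  note D = groupoid_actionsD[OF act]
  have cont: "continuous_map (subtopology Y {y \<in> topspace Y. \<rho> y = src U h})
      (subtopology Y {y \<in> topspace Y. \<rho> y = rng U h}) (m h)" if h: "h \<in> carrier U" for h
  proof -
    have "{y \<in> topspace Y. \<rho> y = src U h} = topspace Y \<inter> {y. src U h = \<rho> y}" by auto
    then have "subtopology Y {y \<in> topspace Y. \<rho> y = src U h} = subtopology Y {y. src U h = \<rho> y}"
      by (metis subtopology_restrict)
    then show ?thesis
      using D(5)[OF h] D(6,9)[OF h] by (auto simp: continuous_map_in_subtopology)
  qed
  have inv: "m (ginv U h) (m h y) = y" if "h \<in> carrier U" "y \<in> topspace Y" "\<rho> y = src U h" for h y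
    using D(7)[of "ginv U h" h y] D(8)[of y] that by simp
  have "homeomorphic_maps (subtopology Y {y \<in> topspace Y. \<rho> y = src U g})
    (subtopology Y {y \<in> topspace Y. \<rho> y = rng U g}) (m g) (m (ginv U g))"
    unfolding homeomorphic_maps_def
    using cont[OF g] cont[of "ginv U g"] inv[OF g] inv[of "ginv U g"] g by auto
  then show ?thesis by (rule homeomorphic_maps_imp_map)
qed

text \<open>
  The pieces are the fibres of a continuous map to a discrete space, hence clopen. Every \<open>a g \<gamma>\<close> is
  the translation by one arrow of the groupoid, hence a homeomorphism between two pieces; this
  gives all the topological conditions, and injectivity of \<open>a g \<gamma>\<close> gives the last condition.
\<close>

lemma \<Phi>_in_diagram_actions:
  assumes act: "\<alpha> \<in> groupoid_actions DU Y"
  shows "\<Phi> Y \<alpha> \<in> diagram_actions F Y"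
proof -
  obtain \<rho> m where \<alpha>: "\<alpha> = (\<rho>, m)" by (cases \<alpha>)
  note D = groupoid_actionsD[OF act[unfolded \<alpha>]]
  define X where "X = restrict (fibre Y \<rho>) (obj C)"
  define a where "a = (\<lambda>g \<gamma> y. if g \<in> carrier C \<and> \<gamma> \<in> carrier (G (src C g)) \<and> y \<in> fibre Y \<rho> (src C g)
       then m (E g \<gamma>) y else undefined)"
  have X: "X x = {y \<in> topspace Y. \<rho> y = q (x, [])}" if "x \<in> obj C" for x
    using that by (simp add: X_def fibre_def)
  have Xs: "X (src C g) = {y \<in> topspace Y. \<rho> y = src U (E g \<gamma>)}"
    and Xr: "X (rng C g) = {y \<in> topspace Y. \<rho> y = rng U (E g \<gamma>)}"
    if "g \<in> carrier C" "\<gamma> \<in> carrier (G (src C g))" for g \<gamma>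
    using that by (simp_all add: X src_in_obj rng_in_obj)
  have a: "a g \<gamma> y = m (E g \<gamma>) y"
    if "g \<in> carrier C" "\<gamma> \<in> carrier (G (src C g))" "y \<in> X (src C g)" for g \<gamma> y
    using that by (simp add: a_def X_def src_in_obj)
  have disj: "disjoint_family_on X (obj C)"
    by (auto simp: disjoint_family_on_def X q_object_eq_iff)
  have union: "(\<Union>x\<in>obj C. X x) = topspace Y"
    using D(3) by (auto simp: X obj_U)
  have op: "openin Y (X x)" if "x \<in> obj C" for x
    using D(4)[of "q (x, [])"] that by (auto simp: X obj_U)
  \<comment> \<open>The complement of a piece is the union of the other pieces.\<close>
  have cl: "closedin Y (X x)" if x: "x \<in> obj C" for x
  proof -
    have "topspace Y - X x = (\<Union>x'\<in>obj C - {x}. X x')"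
      using union disj x by (auto simp: disjoint_family_on_def)
    moreover have "openin Y (\<Union>x'\<in>obj C - {x}. X x')" using op by auto
    ultimately show ?thesis using openin_subset[OF op[OF x]] by (simp add: closedin_def)
  qed
  have homeo: "homeomorphic_map (subtopology Y (X (src C g))) (subtopology Y (X (rng C g))) (a g \<gamma>)"
    if g: "g \<in> carrier C" and \<gamma>: "\<gamma> \<in> carrier (G (src C g))" for g \<gamma>
  proof -
    have "homeomorphic_map (subtopology Y (X (src C g))) (subtopology Y (X (rng C g))) (m (E g \<gamma>))"
      using translation_homeomorphic_map[OF act[unfolded \<alpha>], of "E g \<gamma>"] g \<gamma>
      unfolding Xs[OF g \<gamma>] Xr[OF g \<gamma>] by simp
    then show ?thesis
      by (rule homeomorphic_map_eq) (use g \<gamma> a in auto)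
  qed
  have closed: "a g \<gamma> y \<in> X (rng C g)"
    if "g \<in> carrier C" "\<gamma> \<in> carrier (G (src C g))" "y \<in> X (src C g)" for g \<gamma> y
    using that D(6,9) unfolding a[OF that] Xs[OF that(1,2)] Xr[OF that(1,2)] by auto
  have cont: "continuous_map D' R' (\<lambda>(\<gamma>, y). a g \<gamma> y) \<and> open_map D' R' (\<lambda>(\<gamma>, y). a g \<gamma> y) \<and>
      (\<lambda>(\<gamma>, y). a g \<gamma> y) ` topspace D' = topspace R'"
    if g: "g \<in> carrier C"
      and D': "D' = prod_topology (discrete_topology (carrier (G (src C g)))) (subtopology Y (X (src C g)))"
      and R': "R' = subtopology Y (X (rng C g))" for g D' R'
  proof (intro conjI)
    show "continuous_map D' R' (\<lambda>(\<gamma>, y). a g \<gamma> y)"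
      unfolding D' R'
      using homeomorphic_imp_continuous_map[OF homeo[OF g]]
      by (simp add: continuous_map_discrete_prod_iff[where D = UNIV, simplified])
    show "open_map D' R' (\<lambda>(\<gamma>, y). a g \<gamma> y)"
      unfolding D' R'
      by (rule open_map_discrete_prod) (use homeo[OF g] in \<open>auto dest: homeomorphic_imp_open_map\<close>)
    have 1: "\<one>\<^bsub>G (src C g)\<^esub> \<in> carrier (G (src C g))" using g by (simp add: one_closed src_in_obj)
    have "topspace R' \<subseteq> a g \<one>\<^bsub>G (src C g)\<^esub> ` topspace (subtopology Y (X (src C g)))"
      unfolding R' using homeomorphic_imp_surjective_map[OF homeo[OF g 1]] by simp
    then show "(\<lambda>(\<gamma>, y). a g \<gamma> y) ` topspace D' = topspace R'"
      using closed[OF g] homeomorphic_imp_surjective_map[OF homeo[OF g]] 1 unfolding D' R' by fastforce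
  qed
  have assoc: "a g\<^sub>1 \<gamma>\<^sub>1 (a g\<^sub>2 \<gamma>\<^sub>2 y) = a (cmp C g\<^sub>1 g\<^sub>2) (cmult F g\<^sub>1 g\<^sub>2 \<gamma>\<^sub>1 \<gamma>\<^sub>2) y"
    if g: "g\<^sub>1 \<in> carrier C" "g\<^sub>2 \<in> carrier C" "src C g\<^sub>1 = rng C g\<^sub>2"
      and \<gamma>: "\<gamma>\<^sub>1 \<in> carrier (G (src C g\<^sub>1))" "\<gamma>\<^sub>2 \<in> carrier (G (src C g\<^sub>2))"
      and y: "y \<in> X (src C g\<^sub>2)" for g\<^sub>1 g\<^sub>2 \<gamma>\<^sub>1 \<gamma>\<^sub>2 y
  proof -
    have c: "cmult F g\<^sub>1 g\<^sub>2 \<gamma>\<^sub>1 \<gamma>\<^sub>2 \<in> carrier (G (src C g\<^sub>2))"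
      using g \<gamma> by (simp add: mult_closed u_closed \<phi>_closed src_in_obj)
    have "a g\<^sub>1 \<gamma>\<^sub>1 (a g\<^sub>2 \<gamma>\<^sub>2 y) = m (E g\<^sub>1 \<gamma>\<^sub>1) (m (E g\<^sub>2 \<gamma>\<^sub>2) y)"
      using a closed g \<gamma> y by simp
    also have "\<dots> = m (cmp U (E g\<^sub>1 \<gamma>\<^sub>1) (E g\<^sub>2 \<gamma>\<^sub>2)) y"
      using g \<gamma> y by (intro D(7)) (simp_all add: X src_in_obj)
    also have "\<dots> = a (cmp C g\<^sub>1 g\<^sub>2) (cmult F g\<^sub>1 g\<^sub>2 \<gamma>\<^sub>1 \<gamma>\<^sub>2) y"
      using g \<gamma> y c by (simp add: E_mult a)
    finally show ?thesis .
  qed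
  have tight: "\<exists>\<eta>\<in>carrier (G (src C g)). \<gamma>' = \<gamma> \<otimes>\<^bsub>G (src C g)\<^esub> \<eta> \<and> y = a (src C g) \<eta> y'"
    if g: "g \<in> carrier C" and \<gamma>: "\<gamma> \<in> carrier (G (src C g))" "\<gamma>' \<in> carrier (G (src C g))"
      and y: "y \<in> X (src C g)" "y' \<in> X (src C g)" and eq: "a g \<gamma> y = a g \<gamma>' y'" for g \<gamma> \<gamma>' y y'
  proof -
    let ?K = "G (src C g)"
    interpret K: group ?K using group_src[OF g] .
    define \<eta> where "\<eta> = inv\<^bsub>?K\<^esub> \<gamma> \<otimes>\<^bsub>?K\<^esub> \<gamma>'"
    have \<eta>: "\<eta> \<in> carrier ?K" "\<gamma>' = \<gamma> \<otimes>\<^bsub>?K\<^esub> \<eta>"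
      using \<gamma> by (simp_all add: \<eta>_def K.m_assoc[symmetric])
    have s: "src C g \<in> obj C" "src C (src C g) = src C g" using g by (simp_all add: src_in_obj)
    have \<eta>y: "a (src C g) \<eta> y' \<in> X (src C g)"
      using closed[of "src C g" \<eta> y'] g \<eta> y by simp
    \<comment> \<open>Since \<open>a g \<gamma>'\<close> is \<open>a g \<gamma>\<close> after \<open>\<eta>\<close>, injectivity of \<open>a g \<gamma>\<close> gives the claim.\<close>
    have "a g \<gamma> y = a g \<gamma> (a (src C g) \<eta> y')"
      using assoc[of g "src C g" \<gamma> \<eta> y'] eq g \<gamma> \<eta> y \<phi>_id[OF s(1)]
      by (simp add: u_src)
    then have "y = a (src C g) \<eta> y'"
      using homeomorphic_imp_injective_map[OF homeo[OF g \<gamma>(1)]] y \<eta>y openin_subset[OF op[OF s(1)]]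
      by (auto simp: inj_on_def)
    with \<eta> show ?thesis by blast
  qed
  have "(X, a) \<in> diagram_actions F Y"
    unfolding diagram_actions_def mem_Collect_eq prod.case
  proof (intro conjI)
    show "X \<in> extensional (obj (shape F))" by (simp add: X_def)
    show "\<forall>g \<gamma> y. \<not> (g \<in> carrier (shape F) \<and> \<gamma> \<in> corr F g \<and> y \<in> X (src (shape F) g)) \<longrightarrow> a g \<gamma> y = undefined"
      by (auto simp: a_def X_def src_in_obj)
    show "\<forall>g\<in>carrier (shape F).
        let D = prod_topology (discrete_topology (corr F g)) (subtopology Y (X (src (shape F) g)));
            R = subtopology Y (X (rng (shape F) g));
            m = (\<lambda>(\<gamma>, y). a g \<gamma> y)
        in continuous_map D R m \<and> open_map D R m \<and> m ` topspace D = topspace R"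
      unfolding Let_def using cont by simp
  qed (use op cl disj union assoc tight in auto)
  then show ?thesis by (simp add: \<alpha> \<Phi>_def X_def a_def)
qed

text \<open>
  A map that commutes with the elements of all bimodules commutes with the generators
  \<open>A g = E g 1\<close> and \<open>L x \<gamma> = E x \<gamma>\<close>, hence with their inverses and with all arrows.
\<close>

lemma equivariant_iff:
  assumes act: "\<alpha> \<in> groupoid_actions DU Y" and act': "\<alpha>' \<in> groupoid_actions DU Y'"
    and f: "f ` topspace Y \<subseteq> topspace Y'"
  shows "groupoid_equivariant DU Y \<alpha> \<alpha>' f \<longleftrightarrow> diagram_equivariant F (\<Phi> Y \<alpha>) (\<Phi> Y' \<alpha>') f"
proof -
  obtain \<rho> m where \<alpha>: "\<alpha> = (\<rho>, m)" by (cases \<alpha>)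
  obtain \<rho>' m' where \<alpha>': "\<alpha>' = (\<rho>', m')" by (cases \<alpha>')
  note D = groupoid_actionsD[OF act[unfolded \<alpha>]]
  note D' = groupoid_actionsD[OF act'[unfolded \<alpha>']]
  have ft: "f y \<in> topspace Y'" if "y \<in> topspace Y" for y using f that by auto
  show ?thesis
  proof
    assume "groupoid_equivariant DU Y \<alpha> \<alpha>' f"
    then have "\<forall>y\<in>topspace Y. \<rho>' (f y) = \<rho> y"
      "\<forall>g\<in>carrier U. \<forall>y\<in>topspace Y. src U g = \<rho> y \<longrightarrow> f (m g y) = m' g (f y)"
      by (simp_all add: groupoid_equivariant_def \<alpha> \<alpha>')
    then show "diagram_equivariant F (\<Phi> Y \<alpha>) (\<Phi> Y' \<alpha>') f"
      using ft by (auto simp: diagram_equivariant_def \<alpha> \<alpha>' \<Phi>_def fibre_def src_in_obj)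
  next
    assume R: "diagram_equivariant F (\<Phi> Y \<alpha>) (\<Phi> Y' \<alpha>') f"
    have \<rho>: "\<rho>' (f y) = \<rho> y" if y: "y \<in> topspace Y" for y
    proof -
      obtain x where "x \<in> obj C" "\<rho> y = q (x, [])" using D(3)[OF y] obj_U by auto
      with R y show ?thesis by (auto simp: diagram_equivariant_def \<alpha> \<alpha>' \<Phi>_def fibre_def)
    qed
    have fE: "f (m (E g \<gamma>) y) = m' (E g \<gamma>) (f y)"
      if "g \<in> carrier C" "\<gamma> \<in> carrier (G (src C g))" "y \<in> topspace Y" "\<rho> y = q (src C g, [])" for g \<gamma> y
      using R that \<rho>[OF that(3)] ft[OF that(3)]
      by (auto simp: diagram_equivariant_def \<alpha> \<alpha>' \<Phi>_def fibre_def src_in_obj)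
    have fA: "f (m (A g) y) = m' (A g) (f y)"
      if "g \<in> carrier C" "y \<in> topspace Y" "\<rho> y = q (src C g, [])" for g y
      using fE[of g "\<one>\<^bsub>G (src C g)\<^esub>"] that by (simp add: E_one one_closed src_in_obj)
    have fL: "f (m (L x \<gamma>) y) = m' (L x \<gamma>) (f y)"
      if "x \<in> obj C" "\<gamma> \<in> carrier (G x)" "y \<in> topspace Y" "\<rho> y = q (x, [])" for x \<gamma> y
      using fE[of x \<gamma>] that by (simp add: E_obj obj_closed src_obj)
    have step: "\<forall>y\<in>topspace Y. src U (cmp U K B) = \<rho> y \<longrightarrow> f (m (cmp U K B) y) = m' (cmp U K B) (f y)"
      if K: "K \<in> carrier U" and B: "B \<in> carrier U" "src U K = rng U B"
        and fK: "\<And>y. \<lbrakk>y \<in> topspace Y; \<rho> y = src U K\<rbrakk> \<Longrightarrow> f (m K y) = m' K (f y)"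
        and fB: "\<forall>y\<in>topspace Y. src U B = \<rho> y \<longrightarrow> f (m B y) = m' B (f y)" for K B
    proof (intro ballI impI)
      fix y assume y: "y \<in> topspace Y" "src U (cmp U K B) = \<rho> y"
      then have s: "src U B = \<rho> y" using K B by simp
      have "f (m (cmp U K B) y) = f (m K (m B y))" using D(7)[OF K B(1) y(1) B(2) s] by simp
      also have "\<dots> = m' K (f (m B y))" using fK D(6,9)[OF B(1) y(1) s] B(2) by simp
      also have "\<dots> = m' K (m' B (f y))" using fB y(1) s by simp
      also have "\<dots> = m' (cmp U K B) (f y)" using D'(7)[OF K B(1) ft[OF y(1)] B(2)] s \<rho>[OF y(1)] by simp
      finally show "f (m (cmp U K B) y) = m' (cmp U K B) (f y)" .
    qed
    have inv: "f (m (ginv U K) y) = m' (ginv U K) (f y)"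
      if K: "K \<in> carrier U" and y: "y \<in> topspace Y" "\<rho> y = rng U K"
        and fK: "\<And>y. \<lbrakk>y \<in> topspace Y; \<rho> y = src U K\<rbrakk> \<Longrightarrow> f (m K y) = m' K (f y)" for K y
    proof -
      define z where "z = m (ginv U K) y"
      have z: "z \<in> topspace Y" "\<rho> z = src U K"
        using D(6,9)[of "ginv U K" y] K y by (simp_all add: z_def)
      have "y = m K z" using D(7)[of K "ginv U K" y] D(8)[of y] K y by (simp add: z_def)
      then have "m' (ginv U K) (f y) = m' (ginv U K) (m' K (f z))" using fK z by simp
      also have "\<dots> = f z"
        using D'(7)[of "ginv U K" K "f z"] D'(8)[of "f z"] K z ft[OF z(1)] \<rho>[OF z(1)] by simp
      finally show ?thesis by (simp add: z_def)
    qed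
    have "\<forall>y\<in>topspace Y. src U B = \<rho> y \<longrightarrow> f (m B y) = m' B (f y)" if "B \<in> carrier U" for B
      using that
    proof (induction rule: U_induct)
      case (object x)
      have "src U (q (x, [])) = q (x, [])" using object by (simp add: q_simps path_simps)
      then show ?case using D(8) D'(8) ft \<rho> by metis
    next
      case (arrow g B)
      then show ?case using fA by (intro step) auto
    next
      case (loop x \<gamma> B)
      then show ?case using fL by (intro step) auto
    next
      case (inverse_arrow g B)
      then show ?case using fA inv[of "A g"] by (intro step) auto
    next
      case (inverse_loop x \<gamma> B)
      then show ?case using fL inv[of "L x \<gamma>"] by (intro step) auto
    qed
    with \<rho> show "groupoid_equivariant DU Y \<alpha> \<alpha>' f" by (simp add: groupoid_equivariant_def \<alpha> \<alpha>')
  qed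
qed

text \<open>
  The identity map is equivariant between two groupoid actions with the same diagram action, and
  this says that they have the same anchor map and the same multiplication.
\<close>

lemma inj_on_\<Phi>: "inj_on (\<Phi> Y) (groupoid_actions DU Y)"
proof (rule inj_onI)
  fix \<alpha> \<alpha>' assume act: "\<alpha> \<in> groupoid_actions DU Y" "\<alpha>' \<in> groupoid_actions DU Y"
    and eq: "\<Phi> Y \<alpha> = \<Phi> Y \<alpha>'"
  obtain \<rho> m where \<alpha>: "\<alpha> = (\<rho>, m)" by (cases \<alpha>)
  obtain \<rho>' m' where \<alpha>': "\<alpha>' = (\<rho>', m')" by (cases \<alpha>')
  note D = groupoid_actionsD[OF act(1)[unfolded \<alpha>]]
  note D' = groupoid_actionsD[OF act(2)[unfolded \<alpha>']]
  have "diagram_equivariant F (\<Phi> Y \<alpha>) (\<Phi> Y \<alpha>') (\<lambda>y. y)"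
    unfolding eq by (cases "\<Phi> Y \<alpha>'") (simp add: diagram_equivariant_def)
  then have e: "groupoid_equivariant DU Y \<alpha> \<alpha>' (\<lambda>y. y)"
    using equivariant_iff[OF act] by simp
  have \<rho>: "\<rho> = \<rho>'"
    by (rule extensionalityI[OF D(1) D'(1)]) (use e in \<open>auto simp: groupoid_equivariant_def \<alpha> \<alpha>'\<close>)
  have "m g y = m' g y" for g y
    using e D(2)[of g y] D'(2)[of g y] \<rho> by (cases "g \<in> carrier U \<and> y \<in> topspace Y \<and> src U g = \<rho> y")
      (auto simp: groupoid_equivariant_def \<alpha> \<alpha>')
  then have "m = m'" by (intro ext)
  with \<rho> show "\<alpha> = \<alpha>'" by (simp add: \<alpha> \<alpha>')
qed

end

section \<open>From actions of the diagram to actions of the groupoid\<close>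

locale diagram_action = plain_group_diagram C G \<phi> u
  for C :: "'c cat" and G :: "'c \<Rightarrow> 'b monoid" and \<phi> u +
  fixes Y :: "'y topology" and X :: "'c \<Rightarrow> 'y set" and a :: "'c \<Rightarrow> 'b \<Rightarrow> 'y \<Rightarrow> 'y"
  assumes action: "(X, a) \<in> diagram_actions F Y"
begin

lemmas action_unfolded = action[unfolded diagram_actions_def mem_Collect_eq prod.case Let_def diagram_simps]

lemma X_extensional: "X \<in> extensional (obj C)"
  and X_open: "x \<in> obj C \<Longrightarrow> openin Y (X x)"
  and X_disjoint: "disjoint_family_on X (obj C)"
  and X_union: "(\<Union>x\<in>obj C. X x) = topspace Y"
  and a_undefined: "\<not> (g \<in> carrier C \<and> \<gamma> \<in> carrier (G (src C g)) \<and> y \<in> X (src C g)) \<Longrightarrow> a g \<gamma> y = undefined"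
  using action_unfolded by blast+

lemma X_subset: "x \<in> obj C \<Longrightarrow> X x \<subseteq> topspace Y"
  using X_union by auto

lemma a_continuous_open_onto:
  assumes "g \<in> carrier C"
  defines "D \<equiv> prod_topology (discrete_topology (carrier (G (src C g)))) (subtopology Y (X (src C g)))"
  shows "continuous_map D (subtopology Y (X (rng C g))) (\<lambda>(\<gamma>, y). a g \<gamma> y)"
    and "open_map D (subtopology Y (X (rng C g))) (\<lambda>(\<gamma>, y). a g \<gamma> y)"
    and "(\<lambda>(\<gamma>, y). a g \<gamma> y) ` topspace D = topspace (subtopology Y (X (rng C g)))"
  using action_unfolded assms(1) unfolding D_def by blast+

lemma a_assoc:
  "\<lbrakk>g \<in> carrier C; h \<in> carrier C; src C g = rng C h; \<gamma>\<^sub>1 \<in> carrier (G (src C g));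
    \<gamma>\<^sub>2 \<in> carrier (G (src C h)); y \<in> X (src C h)\<rbrakk> \<Longrightarrow>
    a g \<gamma>\<^sub>1 (a h \<gamma>\<^sub>2 y) =
      a (cmp C g h) (u g h \<otimes>\<^bsub>G (src C h)\<^esub> \<phi> h \<gamma>\<^sub>1 \<otimes>\<^bsub>G (src C h)\<^esub> \<gamma>\<^sub>2) y"
  using action_unfolded by blast

lemma a_tight:
  "\<lbrakk>g \<in> carrier C; \<gamma> \<in> carrier (G (src C g)); \<gamma>' \<in> carrier (G (src C g)); y \<in> X (src C g);
    y' \<in> X (src C g); a g \<gamma> y = a g \<gamma>' y'\<rbrakk> \<Longrightarrow>
    \<exists>\<eta>\<in>carrier (G (src C g)). \<gamma>' = \<gamma> \<otimes>\<^bsub>G (src C g)\<^esub> \<eta> \<and> y = a (src C g) \<eta> y'"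
  using action_unfolded by blast

lemma a_closed: "\<lbrakk>g \<in> carrier C; \<gamma> \<in> carrier (G (src C g)); y \<in> X (src C g)\<rbrakk> \<Longrightarrow> a g \<gamma> y \<in> X (rng C g)"
  using a_continuous_open_onto(3)[of g] X_subset[OF src_in_obj] by fastforce

lemma a_src:
  assumes "g \<in> carrier C" "\<gamma> \<in> carrier (G (src C g))" "\<eta> \<in> carrier (G (src C g))" "y \<in> X (src C g)"
  shows "a g \<gamma> (a (src C g) \<eta> y) = a g (\<gamma> \<otimes>\<^bsub>G (src C g)\<^esub> \<eta>) y"
proof -
  interpret K: group "G (src C g)" by (rule group_src) fact
  show ?thesis
    using a_assoc[of g "src C g" \<gamma> \<eta> y] assms by (simp add: u_src \<phi>_id src_in_obj)
qed

lemma a_rng: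
  assumes "g \<in> carrier C" "\<gamma> \<in> carrier (G (rng C g))" "\<eta> \<in> carrier (G (src C g))" "y \<in> X (src C g)"
  shows "a (rng C g) \<gamma> (a g \<eta> y) = a g (\<phi> g \<gamma> \<otimes>\<^bsub>G (src C g)\<^esub> \<eta>) y"
proof -
  interpret K: group "G (src C g)" by (rule group_src) fact
  show ?thesis
    using a_assoc[of "rng C g" g \<gamma> \<eta> y] assms by (simp add: u_rng \<phi>_closed)
qed

text \<open>
  The unit of the group acts as an idempotent map, which is the identity because the group acts
  surjectively.
\<close>

lemma a_one:
  assumes x: "x \<in> obj C" and y: "y \<in> X x"
  shows "a x \<one>\<^bsub>G x\<^esub> y = y"
proof -
  interpret K: group "G x" by (rule groups) fact
  have c: "x \<in> carrier C" "src C x = x" "rng C x = x"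
    using x by (simp_all add: obj_closed src_obj rng_obj)
  have "y \<in> (\<lambda>(\<gamma>, y). a x \<gamma> y) ` (carrier (G x) \<times> X x)"
    using a_continuous_open_onto(3)[OF c(1)] y X_subset[OF x] c by (auto simp: Int_absorb1)
  then obtain \<gamma> z where "\<gamma> \<in> carrier (G x)" "z \<in> X x" "y = a x \<gamma> z" by auto
  then show ?thesis using a_src[of x "\<one>\<^bsub>G x\<^esub>" \<gamma> z] c by simp
qed

text \<open>
  Although only the map on the whole product is assumed to be onto, each single \<open>a g \<gamma>\<close> is, because
  the group acts simply transitively on its bimodule from the right. Injectivity comes from the
  last condition on actions: there, \<open>\<gamma> = \<gamma> \<eta>\<close> forces \<open>\<eta>\<close> to be the unit.
\<close>

lemma a_homeomorphic_map:
  assumes g: "g \<in> carrier C" and \<gamma>: "\<gamma> \<in> carrier (G (src C g))"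
  shows "homeomorphic_map (subtopology Y (X (src C g))) (subtopology Y (X (rng C g))) (a g \<gamma>)"
proof (rule bijective_open_imp_homeomorphic_map)
  let ?s = "src C g" and ?K = "G (src C g)"
  interpret K: group ?K by (rule group_src) fact
  have top: "topspace (subtopology Y (X ?s)) = X ?s" "topspace (subtopology Y (X (rng C g))) = X (rng C g)"
    using X_subset[OF src_in_obj[OF g]] X_subset[OF rng_in_obj[OF g]] by auto
  show "continuous_map (subtopology Y (X ?s)) (subtopology Y (X (rng C g))) (a g \<gamma>)"
    using a_continuous_open_onto(1)[OF g] \<gamma>
    by (simp add: continuous_map_discrete_prod_iff[where D = UNIV, simplified])
  show "open_map (subtopology Y (X ?s)) (subtopology Y (X (rng C g))) (a g \<gamma>)"
    using open_map_slice[OF a_continuous_open_onto(2)[OF g] \<gamma>] by simp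
  have "X (rng C g) \<subseteq> a g \<gamma> ` X ?s"
  proof
    fix y assume "y \<in> X (rng C g)"
    then have "y \<in> (\<lambda>(\<gamma>, y). a g \<gamma> y) ` (carrier ?K \<times> X ?s)"
      using a_continuous_open_onto(3)[OF g] top by simp
    then obtain \<gamma>' z where z: "\<gamma>' \<in> carrier ?K" "z \<in> X ?s" "y = a g \<gamma>' z" by auto
    let ?\<eta> = "inv\<^bsub>?K\<^esub> \<gamma> \<otimes>\<^bsub>?K\<^esub> \<gamma>'"
    have "y = a g \<gamma> (a ?s ?\<eta> z)"
      using a_src[OF g \<gamma>, of ?\<eta> z] z \<gamma> by (simp add: K.m_assoc[symmetric])
    moreover have "a ?s ?\<eta> z \<in> X ?s" using a_closed[of ?s ?\<eta> z] g z \<gamma> by simp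
    ultimately show "y \<in> a g \<gamma> ` X ?s" by blast
  qed
  then show "a g \<gamma> ` topspace (subtopology Y (X ?s)) = topspace (subtopology Y (X (rng C g)))"
    unfolding top using a_closed g \<gamma> by auto
  show "inj_on (a g \<gamma>) (topspace (subtopology Y (X ?s)))"
    unfolding top
  proof (rule inj_onI)
    fix y y' assume y: "y \<in> X ?s" "y' \<in> X ?s" "a g \<gamma> y = a g \<gamma> y'"
    from a_tight[OF g \<gamma> \<gamma> y] obtain \<eta> where \<eta>: "\<eta> \<in> carrier ?K" "\<gamma> = \<gamma> \<otimes>\<^bsub>?K\<^esub> \<eta>" "y = a ?s \<eta> y'"
      by auto
    from \<eta>(1,2) \<gamma> have "\<eta> = \<one>\<^bsub>?K\<^esub>" by (metis K.l_cancel_one')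
    with \<eta>(3) y show "y = y'" using a_one[OF src_in_obj[OF g]] by simp
  qed
qed

text \<open>
  The edge \<open>g\<close> acts like the unit in the bimodule of \<open>g\<close>. Any other element of this bimodule acts
  like the edge \<open>g\<close> after a loop.
\<close>

definition T :: "'c + 'c \<times> 'b \<Rightarrow> 'y \<Rightarrow> 'y" where
  "T = case_sum (\<lambda>g. a g \<one>\<^bsub>G (src C g)\<^esub>) (\<lambda>(x, \<gamma>). a x \<gamma>)"

lemma T_simps [simp]: "T (Inl g) = a g \<one>\<^bsub>G (src C g)\<^esub>" "T (Inr (x, \<gamma>)) = a x \<gamma>"
  by (simp_all add: T_def)

lemma T_homeomorphic_map:
  assumes "e \<in> arcs \<Gamma>"
  shows "homeomorphic_map (subtopology Y (X (tail \<Gamma> e))) (subtopology Y (X (head \<Gamma> e))) (T e)"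
proof (cases e)
  case (Inl g)
  then show ?thesis using a_homeomorphic_map[of g] assms by (simp add: one_closed src_in_obj)
next
  case (Inr l)
  then show ?thesis
    using a_homeomorphic_map[of "fst l" "snd l"] assms by (cases l) (simp add: obj_closed src_obj rng_obj)
qed

sublocale edge_action \<Gamma> X T
proof
  fix e assume e: "e \<in> arcs \<Gamma>"
  have "X (tail \<Gamma> e) \<subseteq> topspace Y" "X (head \<Gamma> e) \<subseteq> topspace Y"
    using X_subset e tail_in_verts head_in_verts by auto
  then show "bij_betw (T e) (X (tail \<Gamma> e)) (X (head \<Gamma> e))"
    using homeomorphic_imp_injective_map[OF T_homeomorphic_map[OF e]]
      homeomorphic_imp_surjective_map[OF T_homeomorphic_map[OF e]]
    by (simp add: bij_betw_def Int_absorb1)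
qed

lemma path_map_arrow: "path_map (arrow g) = a g \<one>\<^bsub>G (src C g)\<^esub>"
  and path_map_loop: "path_map (loop x \<gamma>) = a x \<gamma>"
  by (simp_all add: path_map_edge)

lemma path_map_cmp:
  "\<lbrakk>p \<in> carrier P; p' \<in> carrier P; src P p = rng P p'; y \<in> X (fst (src P p'))\<rbrakk> \<Longrightarrow>
    path_map (cmp P p p') y = path_map p (path_map p' y)"
  by (rule path_action.act_cmp)

text \<open>
  The first three kinds of relators act trivially by associativity of the diagram action: for two
  elements of one group; for \<open>\<gamma>\<close> and the unit in the bimodule of \<open>g\<close>, with product \<open>\<phi> g \<gamma>\<close>; and for
  the units in the bimodules of \<open>g\<close> and \<open>h\<close>, with product \<open>u g h\<close>. An identity arrow acts like the
  unit of a group.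
\<close>

lemma relators_act_trivially: "R \<subseteq> path_action.kernel"
proof -
  have 1: "cmp P (cmp P (loop x \<gamma>\<^sub>1) (loop x \<gamma>\<^sub>2)) (ginv P (loop x (\<gamma>\<^sub>1 \<otimes>\<^bsub>G x\<^esub> \<gamma>\<^sub>2))) \<in> path_action.kernel"
    if "x \<in> obj C" "\<gamma>\<^sub>1 \<in> carrier (G x)" "\<gamma>\<^sub>2 \<in> carrier (G x)" for x \<gamma>\<^sub>1 \<gamma>\<^sub>2
    using that a_src[of x \<gamma>\<^sub>1 \<gamma>\<^sub>2]
    by (intro path_action.quotient_in_kernel(1))
      (simp_all add: mult_closed path_map_cmp path_map_loop obj_closed src_obj)
  have 2: "cmp P (cmp P (cmp P (arrow g) (loop (src C g) (\<phi> g \<gamma>))) (ginv P (arrow g)))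
      (ginv P (loop (rng C g) \<gamma>)) \<in> path_action.kernel"
    if g: "g \<in> carrier C" and \<gamma>: "\<gamma> \<in> carrier (G (rng C g))" for g \<gamma>
  proof -
    interpret K: group "G (src C g)" by (rule group_src) fact
    note [simp] = src_in_obj[OF g] rng_in_obj[OF g] \<phi>_closed[OF g \<gamma>]
    have "path_map (cmp P (cmp P (arrow g) (loop (src C g) (\<phi> g \<gamma>))) (ginv P (arrow g))) y =
        path_map (loop (rng C g) \<gamma>) y" if y: "y \<in> X (rng C g)" for y
    proof -
      define z where "z = path_map (ginv P (arrow g)) y"
      have z: "z \<in> X (src C g)"
        using path_action.act_closed[of "ginv P (arrow g)" y] g y by (simp add: z_def)
      have yz: "y = a g \<one>\<^bsub>G (src C g)\<^esub> z"
        using path_action.act_ginv[of "arrow g" y] g y by (simp add: z_def path_map_arrow)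
      have "path_map (cmp P (cmp P (arrow g) (loop (src C g) (\<phi> g \<gamma>))) (ginv P (arrow g))) y
          = a g \<one>\<^bsub>G (src C g)\<^esub> (a (src C g) (\<phi> g \<gamma>) z)"
        using g y z by (simp add: path_map_cmp path_map_arrow path_map_loop z_def)
      also have "\<dots> = a (rng C g) \<gamma> y"
        using g \<gamma> z by (simp add: a_src a_rng yz)
      finally show ?thesis by (simp add: path_map_loop)
    qed
    with g \<gamma> show ?thesis by (intro path_action.quotient_in_kernel(1)) simp_all
  qed
  have 3: "cmp P (ginv P (cmp P (arrow (cmp C g h)) (loop (src C h) (u g h))))
      (cmp P (arrow g) (arrow h)) \<in> path_action.kernel"
    if g: "g \<in> carrier C" and h: "h \<in> carrier C" and gh: "src C g = rng C h" for g h
  proof -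
    interpret K: group "G (src C h)" by (rule group_src) fact
    note [simp] = src_in_obj[OF h] rng_in_obj[OF h] u_closed[OF g h gh]
    have "a (cmp C g h) \<one>\<^bsub>G (src C h)\<^esub> (a (src C h) (u g h) y) =
        a g \<one>\<^bsub>G (rng C h)\<^esub> (a h \<one>\<^bsub>G (src C h)\<^esub> y)" if y: "y \<in> X (src C h)" for y
      using a_src[of "cmp C g h" "\<one>\<^bsub>G (src C h)\<^esub>" "u g h" y]
        a_assoc[of g h "\<one>\<^bsub>G (rng C h)\<^esub>" "\<one>\<^bsub>G (src C h)\<^esub>" y] g h gh y
      by (simp add: \<phi>_one one_closed)
    with g h gh show ?thesis
      by (intro path_action.quotient_in_kernel(2)) (simp_all add: path_map_cmp path_map_arrow path_map_loop)
  qed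
  have 4: "arrow x \<in> path_action.kernel" if "x \<in> obj C" for x
    using that a_one by (simp add: path_action.kernel_def path_map_arrow obj_closed src_obj rng_obj)
  show ?thesis
    unfolding relators_eq using 1 2 3 4 by blast
qed

definition \<rho> :: "'y \<Rightarrow> ('c, 'b) presented_arrow" where
  "\<rho> = restrict (\<lambda>y. q (THE x. x \<in> obj C \<and> y \<in> X x, [])) (topspace Y)"

definition m :: "('c, 'b) presented_arrow \<Rightarrow> 'y \<Rightarrow> 'y" where
  "m B y = (if B \<in> carrier U \<and> y \<in> topspace Y \<and> src U B = \<rho> y
     then path_map (SOME p. p \<in> carrier P \<and> q p = B) y else undefined)"

lemma \<rho>_eq:
  assumes x: "x \<in> obj C" and y: "y \<in> X x"
  shows "\<rho> y = q (x, [])"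
proof -
  have "(THE x. x \<in> obj C \<and> y \<in> X x) = x"
    using x y X_disjoint by (intro the_equality) (auto simp: disjoint_family_on_def)
  then show ?thesis using X_subset[OF x] y by (auto simp: \<rho>_def)
qed

lemma \<rho>_eq_iff:
  assumes x: "x \<in> obj C"
  shows "y \<in> topspace Y \<and> \<rho> y = q (x, []) \<longleftrightarrow> y \<in> X x"
proof
  assume y: "y \<in> topspace Y \<and> \<rho> y = q (x, [])"
  then obtain x' where x': "x' \<in> obj C" "y \<in> X x'" using X_union by auto
  with y have "q (x', []) = q (x, [])" using \<rho>_eq by simp
  with x x' show "y \<in> X x" by (simp add: q_object_eq_iff)
qed (use x \<rho>_eq X_subset[OF x] in auto)

lemma src_path_obj: "p \<in> carrier P \<Longrightarrow> fst (src P p) \<in> obj C \<and> src P p = (fst (src P p), [])"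
  and rng_path_obj: "p \<in> carrier P \<Longrightarrow> fst (rng P p) \<in> obj C \<and> rng P p = (fst (rng P p), [])"
  using path.src_in_obj[of p] path.rng_in_obj[of p] by (auto simp: obj_path)

lemma src_eq_\<rho>_iff:
  assumes "p \<in> carrier P"
  shows "y \<in> topspace Y \<and> src U (q p) = \<rho> y \<longleftrightarrow> y \<in> X (fst (src P p))"
  using \<rho>_eq_iff[of "fst (src P p)" y] src_path_obj[OF assms] q_simps(1)[OF assms] by metis

text \<open>The choice of a representative does not matter, because the relators act trivially.\<close>

lemma m_q:
  assumes p: "p \<in> carrier P" and y: "y \<in> X (fst (src P p))"
  shows "m (q p) y = path_map p y"
proof -
  define p' where "p' = (SOME p'. p' \<in> carrier P \<and> q p' = q p)"
  have p': "p' \<in> carrier P" "q p' = q p"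
    using someI[of "\<lambda>p'. p' \<in> carrier P \<and> q p' = q p" p] p unfolding p'_def by blast+
  have "m (q p) y = path_map p' y"
    using src_eq_\<rho>_iff[OF p, of y] p y by (simp add: m_def p'_def q_simps)
  also have "\<dots> = path_map p y"
    using path_action.act_eq_if_coset_eq[OF relators_act_trivially p p'(1) p'(2)[symmetric] y] by simp
  finally show ?thesis .
qed

lemma m_closed: "\<lbrakk>p \<in> carrier P; y \<in> X (fst (src P p))\<rbrakk> \<Longrightarrow> m (q p) y \<in> X (fst (rng P p))"
  by (simp add: m_q path_action.act_closed)

lemma groupoid_action: "(\<rho>, m) \<in> groupoid_actions DU Y"
  unfolding groupoid_actions_discrete[OF U.small_category_axioms]
proof (intro conjI ballI impI allI)
  show "\<rho> \<in> extensional (topspace Y)" by (simp add: \<rho>_def)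
  show "\<rho> ` topspace Y \<subseteq> obj U"
  proof clarify
    fix y assume "y \<in> topspace Y"
    then have "y \<in> (\<Union>x\<in>obj C. X x)" using X_union by simp
    then obtain x where "x \<in> obj C" "y \<in> X x" by blast
    then show "\<rho> y \<in> obj U" by (auto simp: obj_U \<rho>_eq)
  qed
  show "m B y = undefined" if "\<not> (B \<in> carrier U \<and> y \<in> topspace Y \<and> src U B = \<rho> y)" for B y
    using that by (simp only: m_def if_False)
  show "openin Y {y \<in> topspace Y. \<rho> y = D}" if "D \<in> obj U" for D
    using that \<rho>_eq_iff X_open by (auto simp: obj_U)
  show "m (\<rho> y) y = y" if "y \<in> topspace Y" for y
  proof -
    have "y \<in> (\<Union>x\<in>obj C. X x)" using that X_union by simp
    then obtain x where x: "x \<in> obj C" "y \<in> X x" by blast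
    then have "m (q (x, [])) y = path_map (x, []) y" by (intro m_q) (simp_all add: path_simps)
    with x show ?thesis by (simp add: \<rho>_eq path_map_def)
  qed
next
  fix B assume "B \<in> carrier U"
  then obtain p where p: "p \<in> carrier P" and B: "B = q p" by (auto simp: carrier_U)
  let ?s = "fst (src P p)" and ?r = "fst (rng P p)"
  show "continuous_map (subtopology Y {y. src U B = \<rho> y}) Y (m B)"
  proof -
    have "subtopology Y {y. src U B = \<rho> y} = subtopology Y (topspace Y \<inter> {y. src U B = \<rho> y})"
      by (simp add: subtopology_restrict)
    also have "topspace Y \<inter> {y. src U B = \<rho> y} = X ?s" using src_eq_\<rho>_iff[OF p] B by auto
    finally have e: "subtopology Y {y. src U B = \<rho> y} = subtopology Y (X ?s)" .
    have "continuous_map (subtopology Y (X ?s)) (subtopology Y (X ?r)) (path_map p)"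
      by (rule continuous_path_map) (use T_homeomorphic_map X_subset p in auto)
    then have "continuous_map (subtopology Y (X ?s)) Y (path_map p)"
      by (simp add: continuous_map_in_subtopology)
    then show ?thesis
      unfolding e unfolding B by (rule continuous_map_eq) (simp add: m_q p)
  qed
  fix y
  show "\<rho> (m B y) = rng U B" if "y \<in> topspace Y" "src U B = \<rho> y"
  proof -
    have "y \<in> X ?s" using that src_eq_\<rho>_iff[OF p] B by blast
    then have "\<rho> (m B y) = q (?r, [])" using m_closed[OF p] rng_path_obj[OF p] B \<rho>_eq by blast
    then show ?thesis using rng_path_obj[OF p] B by (metis q_simps(2) p)
  qed
next
  fix B D y assume "B \<in> carrier U" "D \<in> carrier U" and y: "y \<in> topspace Y"
    and BD: "src U B = rng U D" and D: "src U D = \<rho> y"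
  then obtain p p' where p: "p \<in> carrier P" "B = q p" and p': "p' \<in> carrier P" "D = q p'"
    by (auto simp: carrier_U)
  have pp': "src P p = rng P p'"
    using BD p p' by (simp add: q_simps quot.coset_src_eq_rng_iff)
  have y': "y \<in> X (fst (src P p'))" using y D p' src_eq_\<rho>_iff by blast
  have "m B (m D y) = path_map p (path_map p' y)"
    using m_q[OF p(1), of "m D y"] m_closed[OF p'(1) y'] m_q[OF p'(1) y'] p p' pp' by simp
  also have "\<dots> = m (q (cmp P p p')) y"
    using p p' pp' y' by (simp add: m_q path_map_cmp)
  finally show "m B (m D y) = m (cmp U B D) y" using p p' pp' by (simp add: q_cmp)
qed

lemma \<Phi>_groupoid_action: "\<Phi> Y (\<rho>, m) = (X, a)"
proof -
  have fib: "fibre Y \<rho> x = X x" if "x \<in> obj C" for x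
    using \<rho>_eq_iff[OF that] by (auto simp: fibre_def)
  have "restrict (fibre Y \<rho>) (obj C) = X"
    by (rule extensionalityI[OF _ X_extensional]) (simp_all add: fib)
  moreover have "(if g \<in> carrier C \<and> \<gamma> \<in> carrier (G (src C g)) \<and> y \<in> fibre Y \<rho> (src C g)
       then m (E g \<gamma>) y else undefined) = a g \<gamma> y" for g \<gamma> y
  proof (cases "g \<in> carrier C \<and> \<gamma> \<in> carrier (G (src C g)) \<and> y \<in> X (src C g)")
    case True
    then interpret K: group "G (src C g)" by (simp add: group_src)
    have "E g \<gamma> = q (cmp P (arrow g) (loop (src C g) \<gamma>))"
      using True by (simp add: E_def A_def L_def q_cmp src_in_obj)
    also have "m \<dots> y = a g \<gamma> y"
      using True by (simp add: m_q path_map_cmp path_map_arrow path_map_loop a_src src_in_obj)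
    finally show ?thesis using True by (simp add: fib src_in_obj)
  next
    case False
    then have "\<not> (g \<in> carrier C \<and> \<gamma> \<in> carrier (G (src C g)) \<and> y \<in> fibre Y \<rho> (src C g))"
      using fib src_in_obj by blast
    then show ?thesis using a_undefined[OF False] by (simp only: if_False)
  qed
  ultimately show ?thesis by (simp add: \<Phi>_def fun_eq_iff)
qed

end

theorem proposition7p3:
  fixes C :: "'c cat"
    and G :: "'c \<Rightarrow> 'b monoid"
    and \<phi> :: "'c \<Rightarrow> 'b \<Rightarrow> 'b"
    and u :: "'c \<Rightarrow> 'c \<Rightarrow> 'b"
  assumes "group_diagram_data C G \<phi> u"
  shows "groupoid_model TYPE('y) (diagram_of C G \<phi> u)
    (discrete_groupoid (presented_groupoid C G \<phi> u))"
proof -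
  interpret plain_group_diagram C G \<phi> u
    using assms by (simp add: plain_group_diagram_def)
  have "\<Phi> Y ` groupoid_actions DU Y = diagram_actions F Y" for Y :: "'y topology"
  proof
    show "\<Phi> Y ` groupoid_actions DU Y \<subseteq> diagram_actions F Y"
      using \<Phi>_in_diagram_actions by blast
    show "diagram_actions F Y \<subseteq> \<Phi> Y ` groupoid_actions DU Y"
    proof
      fix \<beta> assume \<beta>: "\<beta> \<in> diagram_actions F Y"
      obtain X a where Xa: "\<beta> = (X, a)" by (cases \<beta>)
      interpret diagram_action C G \<phi> u Y X a
        by unfold_locales (use \<beta> Xa in simp)
      show "\<beta> \<in> \<Phi> Y ` groupoid_actions DU Y"
        unfolding Xa using groupoid_action \<Phi>_groupoid_action by (intro image_eqI) auto
    qed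
  qed
  then have "bij_betw (\<Phi> Y) (groupoid_actions DU Y) (diagram_actions F Y)" for Y :: "'y topology"
    by (simp add: bij_betw_def inj_on_\<Phi>)
  moreover have "groupoid_equivariant DU Y \<alpha> \<alpha>' f \<longleftrightarrow> diagram_equivariant F (\<Phi> Y \<alpha>) (\<Phi> Y' \<alpha>') f"
    if "continuous_map Y Y' f" "\<alpha> \<in> groupoid_actions DU Y" "\<alpha>' \<in> groupoid_actions DU Y'"
    for Y Y' :: "'y topology" and f \<alpha> \<alpha>'
    using equivariant_iff[OF that(2,3)] continuous_map_image_subset_topspace[OF that(1)] by blast
  ultimately show ?thesis
    unfolding groupoid_model_def using etale_discrete_groupoid[OF U.small_groupoid_axioms] by blast
qed

end
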